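(* Let $H$ be a real Hilbert space and let $\mathbb X$ be an $H$-valued continuous $(\mathcal F_t)$-semimartingale. Then $\mathbb X$ admits a scalar quadratic variation.
   Context: Fix $T>0$ and a probability space $(\Omega,\mathcal F,\mathbb P)$ with a filtration $(\mathcal F_t)_{t\in[0,T]}$ satisfying the usual conditions. Processes on $[0,T]$ are extended by $\mathbb X_t=\mathbb X_0$ for $t\le0$ and $\mathbb X_t=\mathbb X_T$ for $t\ge T$. An $H$-valued $(\mathcal F_t)$-semimartingale (in the sense of Métivier–Pellaumail) is the sum of an $H$-valued $(\mathcal F_t)$-local martingale and an $H$-valued adapted process with paths of bounded variation. $\mathbb X$ admits a scalar quadratic variation if $\int_0^\cdot\frac{\|\mathbb X_{s+\epsilon}-\mathbb X_s\|_H^2}{\epsilon}ds$ converges, uniformly on $[0,T]$ in probability, as $\epsilon\downarrow0$; the limit is the scalar quadratic variation. *)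

theory Defs
  imports "HOL-Probability.Probability"
begin

text \<open>
  Processes have type \<open>real \<Rightarrow> 'a \<Rightarrow> 'b\<close> (time first); only their values on \<open>[0,T]\<close> matter.
  Everything else is reached through \<open>clip\<close>, which implements the convention
  \<open>X\<^sub>t = X\<^sub>0\<close> for \<open>t \<le> 0\<close> and \<open>X\<^sub>t = X\<^sub>T\<close> for \<open>t \<ge> T\<close>. Extending a filtration in the same way lets the
  library's \<open>filtration\<close> and \<open>stopping_time\<close>, whose index set is a whole type, be used
  for the index set \<open>[0,T]\<close>.
\<close>

definition clip :: "real \<Rightarrow> real \<Rightarrow> real" where
  "clip T t = max 0 (min T t)"

definition extend :: "real \<Rightarrow> (real \<Rightarrow> 'c) \<Rightarrow> real \<Rightarrow> 'c" where
  "extend T X t = X (clip T t)"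

locale usual_filtered_prob_space =
  prob_space P + complete_measure P + filtration "space P" "extend T F"
  for P :: "'a measure" and T :: real and F :: "real \<Rightarrow> 'a measure" +
  assumes T_pos: "0 < T"
    and subalg: "\<And>t. t \<in> {0..T} \<Longrightarrow> subalgebra P (F t)"
    and null_sets_F0: "null_sets P \<subseteq> sets (F 0)"
    and right_continuous: "\<And>t. t \<in> {0..<T} \<Longrightarrow> (\<Inter>u\<in>{t<..T}. sets (F u)) = sets (F t)"

text \<open>
  The library's Bochner integral is restricted to second countable types. The next two definitions
  restate it for arbitrary normed spaces, where Borel measurability has to be replaced
  by strong (Bochner) measurability, that is, almost everywhere approximation by simple functions.
  The \<open>\<sigma>\<close>-algebra \<open>G\<close> and the measure \<open>P\<close> are separate arguments because \<open>G\<close> is typically a member of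
  the filtration, whose own measure plays no role.
\<close>

definition strongly_measurable ::
  "'a measure \<Rightarrow> 'a measure \<Rightarrow> ('a \<Rightarrow> 'b::topological_space) \<Rightarrow> bool" where
  "strongly_measurable P G f \<longleftrightarrow>
     (\<exists>s. (\<forall>i. simple_function G (s i)) \<and> (AE \<omega> in P. (\<lambda>i::nat. s i \<omega>) \<longlonglongrightarrow> f \<omega>))"

definition has_strong_bochner_integral ::
  "'a measure \<Rightarrow> ('a \<Rightarrow> 'b::real_normed_vector) \<Rightarrow> 'b \<Rightarrow> bool" where
  "has_strong_bochner_integral P f x \<longleftrightarrow>
     strongly_measurable P P f \<and>
     (\<exists>s. (\<forall>i. Bochner_Integration.simple_bochner_integrable P (s i)) \<and>
          (\<lambda>i::nat. \<integral>\<^sup>+\<omega>. norm (f \<omega> - s i \<omega>) \<partial>P) \<longlonglongrightarrow> 0 \<and>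
          (\<lambda>i. Bochner_Integration.simple_bochner_integral P (s i)) \<longlonglongrightarrow> x)"

text \<open>\<open>g\<close> is a version of \<open>E[f | G]\<close>; the case \<open>A = space P\<close> gives integrability of both.\<close>

definition is_cond_exp ::
  "'a measure \<Rightarrow> 'a measure \<Rightarrow> ('a \<Rightarrow> 'b::real_normed_vector) \<Rightarrow> ('a \<Rightarrow> 'b) \<Rightarrow> bool" where
  "is_cond_exp P G f g \<longleftrightarrow>
     strongly_measurable P G g \<and>
     (\<forall>A\<in>sets G. \<exists>x.
        has_strong_bochner_integral P (\<lambda>\<omega>. indicator A \<omega> *\<^sub>R f \<omega>) x \<and>
        has_strong_bochner_integral P (\<lambda>\<omega>. indicator A \<omega> *\<^sub>R g \<omega>) x)"

definition adapted ::
  "'a measure \<Rightarrow> real \<Rightarrow> (real \<Rightarrow> 'a measure) \<Rightarrow> (real \<Rightarrow> 'a \<Rightarrow> 'b::topological_space) \<Rightarrow> bool" where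
  "adapted P T F X \<longleftrightarrow> (\<forall>t\<in>{0..T}. strongly_measurable P (F t) (X t))"

definition is_martingale ::
  "'a measure \<Rightarrow> real \<Rightarrow> (real \<Rightarrow> 'a measure) \<Rightarrow> (real \<Rightarrow> 'a \<Rightarrow> 'b::real_normed_vector) \<Rightarrow> bool" where
  "is_martingale P T F M \<longleftrightarrow>
     adapted P T F M \<and>
     (\<forall>s t. 0 \<le> s \<and> s \<le> t \<and> t \<le> T \<longrightarrow> is_cond_exp P (F s) (M t) (M s))"

definition cadlag_path :: "real \<Rightarrow> (real \<Rightarrow> 'b::topological_space) \<Rightarrow> bool" where
  "cadlag_path T x \<longleftrightarrow>
     (\<forall>t\<in>{0..<T}. (x \<longlongrightarrow> x t) (at_right t)) \<and>
     (\<forall>t\<in>{0<..T}. \<exists>l. (x \<longlongrightarrow> l) (at_left t))"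

definition bounded_variation_path :: "real \<Rightarrow> (real \<Rightarrow> 'b::real_normed_vector) \<Rightarrow> bool" where
  "bounded_variation_path T x \<longleftrightarrow>
     (\<exists>C. \<forall>(p :: nat \<Rightarrow> real) n. mono p \<and> range p \<subseteq> {0..T} \<longrightarrow>
        (\<Sum>i<n. norm (x (p (Suc i)) - x (p i))) \<le> C)"

text \<open>
  The initial value is subtracted before stopping, so \<open>M\<^sub>0\<close> need not be integrable. On the
  compact time interval \<open>[0,T]\<close>, localisation means that \<open>\<tau>\<^sub>n\<close> increases and is eventually equal to \<open>T\<close>.
\<close>

definition is_local_martingale ::
  "'a measure \<Rightarrow> real \<Rightarrow> (real \<Rightarrow> 'a measure) \<Rightarrow> (real \<Rightarrow> 'a \<Rightarrow> 'b::real_normed_vector) \<Rightarrow> bool" where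
  "is_local_martingale P T F M \<longleftrightarrow>
     adapted P T F M \<and>
     (AE \<omega> in P. cadlag_path T (\<lambda>t. M t \<omega>)) \<and>
     (\<exists>\<tau> :: nat \<Rightarrow> 'a \<Rightarrow> real.
        (\<forall>n. stopping_time (extend T F) (\<tau> n) \<and> \<tau> n \<in> space P \<rightarrow> {0..T}) \<and>
        (AE \<omega> in P. incseq (\<lambda>n. \<tau> n \<omega>) \<and> (\<exists>n. \<tau> n \<omega> = T)) \<and>
        (\<forall>n. is_martingale P T F (\<lambda>t \<omega>. M (min t (\<tau> n \<omega>)) \<omega> - M 0 \<omega>)))"

definition is_semimartingale ::
  "'a measure \<Rightarrow> real \<Rightarrow> (real \<Rightarrow> 'a measure) \<Rightarrow> (real \<Rightarrow> 'a \<Rightarrow> 'b::real_normed_vector) \<Rightarrow> bool" where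
  "is_semimartingale P T F X \<longleftrightarrow>
     (\<exists>M V. is_local_martingale P T F M \<and>
            adapted P T F V \<and>
            (AE \<omega> in P. bounded_variation_path T (\<lambda>t. V t \<omega>)) \<and>
            (\<forall>t\<in>{0..T}. \<forall>\<omega>\<in>space P. X t \<omega> = M t \<omega> + V t \<omega>))"

definition continuous_process ::
  "'a measure \<Rightarrow> real \<Rightarrow> (real \<Rightarrow> 'a \<Rightarrow> 'b::topological_space) \<Rightarrow> bool" where
  "continuous_process P T X \<longleftrightarrow> (AE \<omega> in P. continuous_on {0..T} (\<lambda>t. X t \<omega>))"

text \<open>
  Uniform convergence on \<open>[0,T]\<close> in probability. The outer measure agrees with \<open>P\<close> on measurable
  events; with \<open>measure P\<close>, a non-measurable event would count as negligible.
\<close>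

definition ucp_tendsto ::
  "'a measure \<Rightarrow> real \<Rightarrow> ('i \<Rightarrow> real \<Rightarrow> 'a \<Rightarrow> real) \<Rightarrow> (real \<Rightarrow> 'a \<Rightarrow> real) \<Rightarrow> 'i filter \<Rightarrow> bool" where
  "ucp_tendsto P T Y Q L \<longleftrightarrow>
     (\<forall>\<delta>>0. ((\<lambda>i. outer_measure_of P
        {\<omega>\<in>space P. ennreal \<delta> < (SUP t\<in>{0..T}. ennreal \<bar>Y i t \<omega> - Q t \<omega>\<bar>)}) \<longlongrightarrow> 0) L)"

definition qv_approx ::
  "real \<Rightarrow> (real \<Rightarrow> 'a \<Rightarrow> 'b::real_normed_vector) \<Rightarrow> real \<Rightarrow> real \<Rightarrow> 'a \<Rightarrow> real" where
  "qv_approx T X \<epsilon> t \<omega> =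
     (LINT s:{0..t}|lborel. (norm (extend T X (s + \<epsilon>) \<omega> - extend T X s \<omega>))\<^sup>2 / \<epsilon>)"

definition is_scalar_qv ::
  "'a measure \<Rightarrow> real \<Rightarrow> (real \<Rightarrow> 'a \<Rightarrow> 'b::real_normed_vector) \<Rightarrow> (real \<Rightarrow> 'a \<Rightarrow> real) \<Rightarrow> bool" where
  "is_scalar_qv P T X Q \<longleftrightarrow>
     (\<forall>t\<in>{0..T}. Q t \<in> borel_measurable P) \<and>
     continuous_process P T Q \<and>
     ucp_tendsto P T (qv_approx T X) Q (at_right 0)"

definition admits_scalar_qv ::
  "'a measure \<Rightarrow> real \<Rightarrow> (real \<Rightarrow> 'a \<Rightarrow> 'b::real_normed_vector) \<Rightarrow> bool" where
  "admits_scalar_qv P T X \<longleftrightarrow> (\<exists>Q. is_scalar_qv P T X Q)"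

end

theory Submission
  imports Defs
begin

text \<open>
  Let \<open>C\<^sub>t\<close> be the approximation with time shift \<open>\<epsilon>\<close>. On a dyadic grid that is much finer than \<open>\<epsilon>\<close>, write
  \<open>X\<^sub>k\<close> for the value at the \<open>k\<close>-th grid point. Expanding the squared norm of
  \<open>X\<^sub>i\<^sub>+\<^sub>q - X\<^sub>i\<close> as a telescoping sum and exchanging the order of summation shows that the Riemann sum
  of \<open>C\<^sub>t\<close> differs from the dyadic sum of the squared increments, up to terms that are as small as the square
  of the oscillation of the path, only by twice the sum of the numbers
  \<open>H\<^sub>k \<bullet> (X\<^sub>k\<^sub>+\<^sub>1 - X\<^sub>k)\<close>. Here \<open>H\<^sub>k\<close> is \<open>X\<^sub>k\<close> minus the average of the path over the
  time window of length \<open>\<epsilon>\<close> that ends at the \<open>k\<close>-th grid point (lemma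
  \<open>averaged_squares_near_quadratic_variation\<close>). So \<open>H\<close> is adapted and, for small \<open>\<epsilon>\<close>, uniformly small. The dyadic
  sum does not depend on \<open>\<epsilon>\<close>. Hence two approximations with small shifts \<open>\<epsilon>\<close> and \<open>\<epsilon>'\<close> are close
  to each other, as soon as the sums of \<open>H\<^sub>k \<bullet> (X\<^sub>k\<^sub>+\<^sub>1 - X\<^sub>k)\<close> are uniformly small with high
  probability, with a bound that does not depend on the grid.

  Such a bound is the lemma \<open>maximal_inequality\<close>. It has to be proved for \<open>X\<close> itself: the local martingale part
  \<open>M\<close> may jump as long as the bounded variation part \<open>V\<close> cancels the jump, and the jump of \<open>M\<close> at an exit
  time is in general integrable but not square integrable. Therefore all increments are suppressed
  from the step on, inclusively, in which \<open>X - X\<^sub>0\<close> leaves a ball or the variation of \<open>V\<close> exceeds a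
  level. The remaining increments \<open>D\<^sub>k\<close> are bounded. The price is one martingale increment at the exit, which is
  controlled in mean. It follows that the expectation of \<open>\<Sum> W\<^sub>k \<bullet> D\<^sub>k\<close> is at most a constant times the
  supremum of the adapted process \<open>W\<close> (lemma \<open>quasimartingale_bound\<close>). This one inequality is used twice. With the
  stopped process itself as \<open>W\<close> it bounds the expectation of \<open>\<Sum> \<bar>D\<^sub>k\<bar>\<^sup>2\<close>. With \<open>W = Y H\<close>, where \<open>Y\<close> is the
  partial sum of \<open>H\<^sub>k \<bullet> D\<^sub>k\<close>, stopped when it exceeds \<open>l\<close>, it bounds the mixed terms in \<open>E Y\<^sup>2\<close>; then
  Chebyshev's inequality shows that \<open>Y\<close> rarely exceeds \<open>l\<close>.

  Martingales enter only through the identity \<open>E (W \<bullet> M\<^sub>t) = E (W \<bullet> M\<^sub>s)\<close> for bounded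
  \<open>W\<close> that are measurable at time \<open>s \<le> t\<close> (lemma \<open>is_cond_exp_inner\<close>), and the processes only through
  their values at dyadic times, which makes all exceptional events measurable. Refining the grid for fixed
  \<open>\<epsilon>\<close> and \<open>\<epsilon>'\<close> carries the estimate over to the integrals (lemma \<open>qv_approx_Cauchy\<close>), and a Borel--Cantelli argument turns
  the Cauchy property into convergence (lemma \<open>ucp_Cauchy_imp_convergent\<close>).
\<close>

section \<open>Strong measurability for a completed sub-\<sigma>-algebra\<close>

text \<open>
  If the sub-\<open>\<sigma>\<close>-algebra contains all null sets, almost everywhere limits of its simple functions have the
  closure properties of measurable functions, and for real functions the two notions agree. This also holds
  for values in a nonseparable space.
\<close>

locale augmented_subalgebra = complete_measure P for P :: "'a measure" +
  fixes G :: "'a measure"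
  assumes subalg: "subalgebra P G"
    and null_sets_subset: "null_sets P \<subseteq> sets G"
begin

lemma space_eq: "space G = space P"
  using subalg by (simp add: subalgebra_def)

lemma sets_subset: "A \<in> sets G \<Longrightarrow> A \<in> sets P"
  using subalg by (auto simp: subalgebra_def)

lemma borel_measurable_P: "f \<in> borel_measurable G \<Longrightarrow> f \<in> borel_measurable P"
  using measurable_from_subalg[OF subalg] .

text \<open>
  On the null set where the limit fails, \<open>f\<close> is arbitrary. All subsets of this null set
  belong to \<open>G\<close> because \<open>P\<close> is complete and \<open>G\<close> contains its null sets.
\<close>

lemma borel_measurable_AE_limit:
  fixes f :: "'a \<Rightarrow> real"
  assumes s: "\<And>i::nat. s i \<in> borel_measurable G"
    and lim: "AE \<omega> in P. (\<lambda>i. s i \<omega>) \<longlonglongrightarrow> f \<omega>"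
  shows "f \<in> borel_measurable G"
proof -
  obtain N where N: "N \<in> null_sets P" "{\<omega>\<in>space P. \<not> (\<lambda>i. s i \<omega>) \<longlonglongrightarrow> f \<omega>} \<subseteq> N"
    using lim by (auto simp: eventually_ae_filter)
  define g where "g \<omega> = lim (\<lambda>i. s i \<omega>)" for \<omega>
  have g: "g \<in> borel_measurable G"
    unfolding g_def using s by (rule borel_measurable_lim_metric)
  have fg: "f \<omega> = g \<omega>" if "\<omega> \<in> space P - N" for \<omega>
    using N that unfolding g_def by (auto intro!: limI[symmetric])
  show ?thesis
  proof (rule measurableI)
    fix A :: "real set" assume A: "A \<in> sets borel"
    have "f -` A \<inter> N \<in> null_sets P"
      by (rule complete2[OF _ N(1)]) auto
    then have 1: "f -` A \<inter> N \<in> sets G"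
      using null_sets_subset by auto
    have "f -` A \<inter> space G = ((g -` A \<inter> space G) - N) \<union> (f -` A \<inter> N)"
      using fg sets.sets_into_space[of N P] N(1) by (auto simp: space_eq)
    moreover have "N \<in> sets G" using N(1) null_sets_subset by auto
    ultimately show "f -` A \<inter> space G \<in> sets G"
      using 1 measurable_sets[OF g A] by auto
  qed auto
qed

lemma strongly_measurable_borel:
  fixes f :: "'a \<Rightarrow> real"
  assumes "strongly_measurable P G f"
  shows "f \<in> borel_measurable G"
proof -
  obtain s where s: "\<And>i. simple_function G (s i)" "AE \<omega> in P. (\<lambda>i::nat. s i \<omega>) \<longlonglongrightarrow> f \<omega>"
    using assms by (auto simp: strongly_measurable_def)
  show ?thesis
    by (rule borel_measurable_AE_limit[OF _ s(2)]) (rule borel_measurable_simple_function[OF s(1)])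
qed

lemma borel_strongly_measurable:
  fixes f :: "'a \<Rightarrow> real"
  assumes "f \<in> borel_measurable G"
  shows "strongly_measurable P G f"
proof -
  obtain s where s: "\<And>i. simple_function G (s i)" "\<And>\<omega>. \<omega> \<in> space G \<Longrightarrow> (\<lambda>i::nat. s i \<omega>) \<longlonglongrightarrow> f \<omega>"
    using borel_measurable_implies_sequence_metric[OF assms, of 0] by auto
  then show ?thesis
    unfolding strongly_measurable_def by (intro exI[of _ s]) (auto simp: space_eq)
qed

lemma strongly_measurable_compose2:
  assumes f: "strongly_measurable P G f" and g: "strongly_measurable P G g"
    and cont: "continuous_on UNIV (\<lambda>z. \<Phi> (fst z) (snd z))"
  shows "strongly_measurable P G (\<lambda>\<omega>. \<Phi> (f \<omega>) (g \<omega>))"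
proof -
  obtain s where s: "\<And>i. simple_function G (s i)" "AE \<omega> in P. (\<lambda>i::nat. s i \<omega>) \<longlonglongrightarrow> f \<omega>"
    using f by (auto simp: strongly_measurable_def)
  obtain r where r: "\<And>i. simple_function G (r i)" "AE \<omega> in P. (\<lambda>i::nat. r i \<omega>) \<longlonglongrightarrow> g \<omega>"
    using g by (auto simp: strongly_measurable_def)
  have "AE \<omega> in P. (\<lambda>i. \<Phi> (s i \<omega>) (r i \<omega>)) \<longlonglongrightarrow> \<Phi> (f \<omega>) (g \<omega>)"
    using s(2) r(2)
  proof eventually_elim
    case (elim \<omega>)
    have "(\<lambda>i. (s i \<omega>, r i \<omega>)) \<longlonglongrightarrow> (f \<omega>, g \<omega>)"
      using elim by (rule tendsto_Pair)
    from continuous_on_tendsto_compose[OF cont this] show ?case by simp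
  qed
  then show ?thesis
    unfolding strongly_measurable_def
    by (intro exI[of _ "\<lambda>i \<omega>. \<Phi> (s i \<omega>) (r i \<omega>)"]) (auto intro: simple_function_compose2 s r)
qed

lemma strongly_measurable_const: "strongly_measurable P G (\<lambda>_. c)"
  unfolding strongly_measurable_def by (intro exI[of _ "\<lambda>_ _. c"]) auto

lemma strongly_measurable_diff:
  fixes f g :: "'a \<Rightarrow> 'b::real_normed_vector"
  assumes "strongly_measurable P G f" "strongly_measurable P G g"
  shows "strongly_measurable P G (\<lambda>\<omega>. f \<omega> - g \<omega>)"
  using assms by (rule strongly_measurable_compose2) (intro continuous_intros)

lemma strongly_measurable_add:
  fixes f g :: "'a \<Rightarrow> 'b::real_normed_vector"
  assumes "strongly_measurable P G f" "strongly_measurable P G g"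
  shows "strongly_measurable P G (\<lambda>\<omega>. f \<omega> + g \<omega>)"
  using assms by (rule strongly_measurable_compose2) (intro continuous_intros)

lemma strongly_measurable_scaleR:
  fixes f :: "'a \<Rightarrow> 'b::real_normed_vector"
  assumes "a \<in> borel_measurable G" "strongly_measurable P G f"
  shows "strongly_measurable P G (\<lambda>\<omega>. a \<omega> *\<^sub>R f \<omega>)"
  using borel_strongly_measurable[OF assms(1)] assms(2)
  by (rule strongly_measurable_compose2) (intro continuous_intros)

lemma strongly_measurable_sum:
  fixes f :: "'i \<Rightarrow> 'a \<Rightarrow> 'b::real_normed_vector"
  assumes "\<And>i. i \<in> I \<Longrightarrow> strongly_measurable P G (f i)"
  shows "strongly_measurable P G (\<lambda>\<omega>. \<Sum>i\<in>I. f i \<omega>)"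
  using assms
  by (induction I rule: infinite_finite_induct)
    (auto intro: strongly_measurable_const strongly_measurable_add)

lemma borel_measurable_norm_strong:
  fixes f :: "'a \<Rightarrow> 'b::real_normed_vector"
  assumes "strongly_measurable P G f"
  shows "(\<lambda>\<omega>. norm (f \<omega>)) \<in> borel_measurable G"
  by (rule strongly_measurable_borel, rule strongly_measurable_compose2[OF assms assms, of "\<lambda>x _. norm x"])
    (intro continuous_intros)

lemma borel_measurable_inner_strong:
  fixes f g :: "'a \<Rightarrow> 'b::real_inner"
  assumes "strongly_measurable P G f" "strongly_measurable P G g"
  shows "(\<lambda>\<omega>. f \<omega> \<bullet> g \<omega>) \<in> borel_measurable G"
  by (rule strongly_measurable_borel, rule strongly_measurable_compose2[OF assms, of "(\<bullet>)"])
    (intro continuous_intros)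

lemma strongly_measurable_enlarge:
  assumes "strongly_measurable P G f" and "sets G \<subseteq> sets G'" "space G' = space P"
  shows "strongly_measurable P G' f"
  using assms unfolding strongly_measurable_def
  by (metis simple_function_subalgebra space_eq)

end

section \<open>Testing conditional expectations with bounded vectors\<close>

lemma augmented_subalgebra_self:
  assumes "complete_measure P"
  shows "augmented_subalgebra P P"
proof -
  interpret complete_measure P by fact
  show ?thesis by standard (auto simp: subalgebra_def null_sets_def)
qed

text \<open>
  Vector-valued integrals are used only through their scalar products with fixed vectors, which are
  integrals of real functions.
\<close>

lemma has_strong_bochner_integral_inner:
  fixes f :: "'a \<Rightarrow> 'b::real_inner"
  assumes "complete_measure P" and f: "has_strong_bochner_integral P f x"
  shows "integrable P (\<lambda>\<omega>. norm (f \<omega>))"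
    and "has_bochner_integral P (\<lambda>\<omega>. h \<bullet> f \<omega>) (h \<bullet> x)"
proof -
  interpret augmented_subalgebra P P
    using assms(1) by (rule augmented_subalgebra_self)
  obtain s where sm: "strongly_measurable P P f"
    and s: "\<And>i. Bochner_Integration.simple_bochner_integrable P (s i)"
    and lim: "(\<lambda>i::nat. \<integral>\<^sup>+\<omega>. norm (f \<omega> - s i \<omega>) \<partial>P) \<longlonglongrightarrow> 0"
    and lim_x: "(\<lambda>i. Bochner_Integration.simple_bochner_integral P (s i)) \<longlonglongrightarrow> x"
    using f unfolding has_strong_bochner_integral_def by blast
  have s_simple: "simple_function P (s i)" for i
    using s[of i] by (auto elim: simple_bochner_integrable.cases)
  have s_strong: "strongly_measurable P P (s i)" for i
    unfolding strongly_measurable_def using s_simple by (intro exI[of _ "\<lambda>_. s i"]) auto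
  note [measurable] = borel_measurable_norm_strong[OF sm]
    borel_measurable_norm_strong[OF strongly_measurable_diff[OF sm s_strong]]
    borel_measurable_norm_strong[OF s_strong]
  have ns: "integrable P (\<lambda>\<omega>. norm (s i \<omega>))" for i
    by (intro integrableI_simple_bochner_integrable
        simple_bochner_integrable_compose2[where p="\<lambda>x y. norm x", OF _ s s]) auto
  have "eventually (\<lambda>i. (\<integral>\<^sup>+\<omega>. norm (f \<omega> - s i \<omega>) \<partial>P) < 1) sequentially"
    using lim by (rule order_tendstoD) simp
  then obtain i where i: "(\<integral>\<^sup>+\<omega>. norm (f \<omega> - s i \<omega>) \<partial>P) < 1"
    by (auto simp: eventually_sequentially)
  have "integrable P (\<lambda>\<omega>. norm (f \<omega> - s i \<omega>))"
    using less_trans[OF i, of \<infinity>] by (intro integrableI_nonneg) auto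
  from Bochner_Integration.integrable_add[OF this ns[of i]]
  show nf: "integrable P (\<lambda>\<omega>. norm (f \<omega>))"
    by (rule Bochner_Integration.integrable_bound) (auto simp: norm_triangle_sub add.commute)
  show "has_bochner_integral P (\<lambda>\<omega>. h \<bullet> f \<omega>) (h \<bullet> x)"
  proof (rule has_bochner_integral.intros[where s="\<lambda>i \<omega>. h \<bullet> s i \<omega>"])
    show "(\<lambda>\<omega>. h \<bullet> f \<omega>) \<in> borel_measurable P"
      by (rule borel_measurable_inner_strong[OF strongly_measurable_const sm])
    show "Bochner_Integration.simple_bochner_integrable P (\<lambda>\<omega>. h \<bullet> s i \<omega>)" for i
      using simple_bochner_integrable_compose2[where p="\<lambda>x y. h \<bullet> x", OF _ s s] by auto
    show "(\<lambda>i. \<integral>\<^sup>+\<omega>. norm (h \<bullet> f \<omega> - h \<bullet> s i \<omega>) \<partial>P) \<longlonglongrightarrow> 0"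
    proof (rule tendsto_sandwich[of "\<lambda>_. 0" _ _ "\<lambda>i. ennreal (norm h) * (\<integral>\<^sup>+\<omega>. norm (f \<omega> - s i \<omega>) \<partial>P)"])
      have "(\<integral>\<^sup>+\<omega>. norm (h \<bullet> f \<omega> - h \<bullet> s i \<omega>) \<partial>P) \<le> (\<integral>\<^sup>+\<omega>. ennreal (norm h) * norm (f \<omega> - s i \<omega>) \<partial>P)" for i
        by (intro nn_integral_mono)
          (auto simp: inner_diff_right[symmetric] ennreal_mult[symmetric] intro!: ennreal_leI Cauchy_Schwarz_ineq2)
      also have "(\<integral>\<^sup>+\<omega>. ennreal (norm h) * norm (f \<omega> - s i \<omega>) \<partial>P) = ennreal (norm h) * (\<integral>\<^sup>+\<omega>. norm (f \<omega> - s i \<omega>) \<partial>P)" for i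
        by (rule nn_integral_cmult) measurable
      finally show "\<forall>\<^sub>F i in sequentially. (\<integral>\<^sup>+\<omega>. norm (h \<bullet> f \<omega> - h \<bullet> s i \<omega>) \<partial>P)
          \<le> ennreal (norm h) * (\<integral>\<^sup>+\<omega>. norm (f \<omega> - s i \<omega>) \<partial>P)" by simp
      show "(\<lambda>i. ennreal (norm h) * (\<integral>\<^sup>+\<omega>. norm (f \<omega> - s i \<omega>) \<partial>P)) \<longlonglongrightarrow> 0"
        using ennreal_tendsto_cmult[OF _ lim, of "ennreal (norm h)"] by simp
    qed auto
    have "Bochner_Integration.simple_bochner_integral P (\<lambda>\<omega>. h \<bullet> s i \<omega>)
        = h \<bullet> Bochner_Integration.simple_bochner_integral P (s i)" for i
      by (rule simple_bochner_integral_linear[OF bounded_linear.linear[OF bounded_linear_inner_right] s])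
    then show "(\<lambda>i. Bochner_Integration.simple_bochner_integral P (\<lambda>\<omega>. h \<bullet> s i \<omega>)) \<longlonglongrightarrow> h \<bullet> x"
      using tendsto_inner[OF tendsto_const lim_x] by simp
  qed
qed

text \<open>
  For simple \<open>W\<close> the identity is a finite sum of instances of the definition of conditional expectation. A bounded strongly
  measurable \<open>W\<close> is an almost everywhere limit of simple functions that are cut off at \<open>b + 1\<close>, and
  dominated convergence applies. The slack of \<open>1\<close> ensures that the cut-off does not
  affect the approximation in the limit.
\<close>

lemma (in augmented_subalgebra) is_cond_exp_inner:
  fixes f g :: "'a \<Rightarrow> 'b::real_inner"
  assumes fg: "is_cond_exp P G f g" and f: "strongly_measurable P P f"
    and W: "strongly_measurable P G W" "\<And>\<omega>. \<omega> \<in> space P \<Longrightarrow> norm (W \<omega>) \<le> b"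
  shows "integrable P (\<lambda>\<omega>. norm (f \<omega>))" "integrable P (\<lambda>\<omega>. norm (g \<omega>))"
    and "(\<integral>\<omega>. W \<omega> \<bullet> f \<omega> \<partial>P) = (\<integral>\<omega>. W \<omega> \<bullet> g \<omega> \<partial>P)"
proof -
  interpret PP: augmented_subalgebra P P
    using complete_measure_axioms by (rule augmented_subalgebra_self)
  note cm = complete_measure_axioms
  have g: "strongly_measurable P P g"
    by (rule strongly_measurable_enlarge[of g]) (use fg in \<open>auto simp: is_cond_exp_def intro: sets_subset\<close>)
  have A: "\<exists>x. has_strong_bochner_integral P (\<lambda>\<omega>. indicator A \<omega> *\<^sub>R f \<omega>) x \<and>
        has_strong_bochner_integral P (\<lambda>\<omega>. indicator A \<omega> *\<^sub>R g \<omega>) x" if "A \<in> sets G" for A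
    using fg that by (auto simp: is_cond_exp_def)
  have "space P \<in> sets G" using space_eq sets.top[of G] by simp
  from A[OF this] obtain x where x:
    "has_strong_bochner_integral P (\<lambda>\<omega>. indicator (space P) \<omega> *\<^sub>R f \<omega>) x"
    "has_strong_bochner_integral P (\<lambda>\<omega>. indicator (space P) \<omega> *\<^sub>R g \<omega>) x" by blast
  show nf: "integrable P (\<lambda>\<omega>. norm (f \<omega>))"
    using has_strong_bochner_integral_inner(1)[OF cm x(1)]
    by (rule Bochner_Integration.integrable_cong[THEN iffD1, OF refl, rotated]) auto
  show ng: "integrable P (\<lambda>\<omega>. norm (g \<omega>))"
    using has_strong_bochner_integral_inner(1)[OF cm x(2)]
    by (rule Bochner_Integration.integrable_cong[THEN iffD1, OF refl, rotated]) auto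
  have int_bdd: "integrable P (\<lambda>\<omega>. V \<omega> \<bullet> u \<omega>)"
    if "strongly_measurable P P V" "strongly_measurable P P u" "integrable P (\<lambda>\<omega>. norm (u \<omega>))"
      "\<And>\<omega>. \<omega> \<in> space P \<Longrightarrow> norm (V \<omega>) \<le> c" for V u :: "'a \<Rightarrow> 'b" and c
  proof (rule Bochner_Integration.integrable_bound)
    show "integrable P (\<lambda>\<omega>. c * norm (u \<omega>))" using that by simp
    show "(\<lambda>\<omega>. V \<omega> \<bullet> u \<omega>) \<in> borel_measurable P"
      using that by (intro PP.borel_measurable_inner_strong)
    show "AE \<omega> in P. norm (V \<omega> \<bullet> u \<omega>) \<le> norm (c * norm (u \<omega>))"
    proof (rule AE_I2)
      fix \<omega> assume "\<omega> \<in> space P"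
      have "norm (V \<omega> \<bullet> u \<omega>) \<le> norm (V \<omega>) * norm (u \<omega>)" by (simp add: Cauchy_Schwarz_ineq2)
      also have "\<dots> \<le> c * norm (u \<omega>)" using that(4)[OF \<open>\<omega> \<in> space P\<close>] by (intro mult_right_mono) auto
      finally show "norm (V \<omega> \<bullet> u \<omega>) \<le> norm (c * norm (u \<omega>))" by simp
    qed
  qed
  have simple: "(\<integral>\<omega>. V \<omega> \<bullet> f \<omega> \<partial>P) = (\<integral>\<omega>. V \<omega> \<bullet> g \<omega> \<partial>P)" if V: "simple_function G V" for V :: "'a \<Rightarrow> 'b"
  proof -
    define S where "S = V ` space P"
    have S: "finite S" using V by (simp add: simple_function_def S_def space_eq)
    define B where "B h = V -` {h} \<inter> space P" for h
    have B: "B h \<in> sets G" if "h \<in> S" for h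
      using V that by (auto simp: simple_function_def S_def B_def space_eq)
    have expand: "V \<omega> \<bullet> u = (\<Sum>h\<in>S. h \<bullet> (indicator (B h) \<omega> *\<^sub>R u))" if "\<omega> \<in> space P" for \<omega> u
    proof -
      have "(\<Sum>h\<in>S. h \<bullet> (indicator (B h) \<omega> *\<^sub>R u)) = (\<Sum>h\<in>{V \<omega>}. h \<bullet> (indicator (B h) \<omega> *\<^sub>R u))"
        using that S by (intro sum.mono_neutral_right) (auto simp: S_def B_def)
      then show ?thesis using that by (simp add: B_def)
    qed
    have "\<exists>x. has_bochner_integral P (\<lambda>\<omega>. h \<bullet> (indicator (B h) \<omega> *\<^sub>R f \<omega>)) (h \<bullet> x) \<and>
       has_bochner_integral P (\<lambda>\<omega>. h \<bullet> (indicator (B h) \<omega> *\<^sub>R g \<omega>)) (h \<bullet> x)" if "h \<in> S" for h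
      using A[OF B[OF that]] has_strong_bochner_integral_inner(2)[OF cm] by blast
    then have "\<forall>h\<in>S. \<exists>x. has_bochner_integral P (\<lambda>\<omega>. h \<bullet> (indicator (B h) \<omega> *\<^sub>R f \<omega>)) (h \<bullet> x) \<and>
       has_bochner_integral P (\<lambda>\<omega>. h \<bullet> (indicator (B h) \<omega> *\<^sub>R g \<omega>)) (h \<bullet> x)" ..
    from bchoice[OF this] obtain x where x0: "\<forall>h\<in>S. has_bochner_integral P (\<lambda>\<omega>. h \<bullet> (indicator (B h) \<omega> *\<^sub>R f \<omega>)) (h \<bullet> x h) \<and>
       has_bochner_integral P (\<lambda>\<omega>. h \<bullet> (indicator (B h) \<omega> *\<^sub>R g \<omega>)) (h \<bullet> x h)"
      ..
    have x:
      "\<And>h. h \<in> S \<Longrightarrow> has_bochner_integral P (\<lambda>\<omega>. h \<bullet> (indicator (B h) \<omega> *\<^sub>R f \<omega>)) (h \<bullet> x h)"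
      "\<And>h. h \<in> S \<Longrightarrow> has_bochner_integral P (\<lambda>\<omega>. h \<bullet> (indicator (B h) \<omega> *\<^sub>R g \<omega>)) (h \<bullet> x h)"
      using x0 by auto
    have "(\<integral>\<omega>. V \<omega> \<bullet> f \<omega> \<partial>P) = (\<Sum>h\<in>S. h \<bullet> x h)"
      using has_bochner_integral_integral_eq[OF has_bochner_integral_sum[OF x(1)]]
      by (simp add: expand cong: Bochner_Integration.integral_cong)
    moreover have "(\<integral>\<omega>. V \<omega> \<bullet> g \<omega> \<partial>P) = (\<Sum>h\<in>S. h \<bullet> x h)"
      using has_bochner_integral_integral_eq[OF has_bochner_integral_sum[OF x(2)]]
      by (simp add: expand cong: Bochner_Integration.integral_cong)
    ultimately show ?thesis by simp
  qed
  obtain s where s: "\<And>i. simple_function G (s i)" "AE \<omega> in P. (\<lambda>i::nat. s i \<omega>) \<longlonglongrightarrow> W \<omega>"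
    using W(1) by (auto simp: strongly_measurable_def)
  define r where "r i \<omega> = (if norm (s i \<omega>) \<le> b + 1 then s i \<omega> else 0)" for i \<omega>
  have r: "simple_function G (r i)" for i
    unfolding r_def using s(1) by (rule simple_function_compose1)
  have r_strong: "strongly_measurable P P (r i)" for i
    unfolding strongly_measurable_def
    using r simple_function_subalgebra[OF r] sets_subset space_eq by (intro exI[of _ "\<lambda>_. r i"]) auto
  have W_P: "strongly_measurable P P W"
    by (rule strongly_measurable_enlarge[OF W(1)]) (auto intro: sets_subset)
  have r_lim: "AE \<omega> in P. (\<lambda>i. r i \<omega>) \<longlonglongrightarrow> W \<omega>"
    using s(2) AE_space
  proof eventually_elim
    case (elim \<omega>)
    have "eventually (\<lambda>i. norm (s i \<omega>) < b + 1) sequentially"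
      using W(2)[OF elim(2)] by (intro order_tendstoD(2)[OF tendsto_norm[OF elim(1)]]) auto
    then have "eventually (\<lambda>i. s i \<omega> = r i \<omega>) sequentially"
      by eventually_elim (auto simp: r_def)
    then show ?case using elim(1) by (rule Lim_transform_eventually[rotated])
  qed
  have lim: "(\<lambda>i. \<integral>\<omega>. r i \<omega> \<bullet> u \<omega> \<partial>P) \<longlonglongrightarrow> (\<integral>\<omega>. W \<omega> \<bullet> u \<omega> \<partial>P)"
    if u: "strongly_measurable P P u" "integrable P (\<lambda>\<omega>. norm (u \<omega>))" for u
  proof (rule integral_dominated_convergence)
    show "integrable P (\<lambda>\<omega>. \<bar>b + 1\<bar> * norm (u \<omega>))" using u by simp
    show "(\<lambda>\<omega>. W \<omega> \<bullet> u \<omega>) \<in> borel_measurable P"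
      using u W_P by (intro PP.borel_measurable_inner_strong)
    show "(\<lambda>\<omega>. r i \<omega> \<bullet> u \<omega>) \<in> borel_measurable P" for i
      using u r_strong by (intro PP.borel_measurable_inner_strong)
    show "AE \<omega> in P. (\<lambda>i. r i \<omega> \<bullet> u \<omega>) \<longlonglongrightarrow> W \<omega> \<bullet> u \<omega>"
      using r_lim by eventually_elim (intro tendsto_intros)
    show "AE \<omega> in P. norm (r i \<omega> \<bullet> u \<omega>) \<le> \<bar>b + 1\<bar> * norm (u \<omega>)" for i
    proof (rule AE_I2)
      fix \<omega>
      have "norm (r i \<omega> \<bullet> u \<omega>) \<le> norm (r i \<omega>) * norm (u \<omega>)" by (simp add: Cauchy_Schwarz_ineq2)
      also have "\<dots> \<le> \<bar>b + 1\<bar> * norm (u \<omega>)" by (intro mult_right_mono) (auto simp: r_def)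
      finally show "norm (r i \<omega> \<bullet> u \<omega>) \<le> \<bar>b + 1\<bar> * norm (u \<omega>)" .
    qed
  qed
  show "(\<integral>\<omega>. W \<omega> \<bullet> f \<omega> \<partial>P) = (\<integral>\<omega>. W \<omega> \<bullet> g \<omega> \<partial>P)"
    using lim[OF f nf] lim[OF g ng] unfolding simple[OF r] by (rule LIMSEQ_unique)
qed

section \<open>A maximal inequality for sums against truncated increments\<close>

text \<open>
  On a grid, \<open>y\<close> is the observed process and \<open>\<mu>\<close> a martingale, both starting at \<open>0\<close>. The numbers \<open>c\<close> and \<open>n\<close>
  are the levels at which \<open>y\<close> and the variation of \<open>y - \<mu>\<close> are cut off. In the application \<open>\<mu>\<close> is
  a localised martingale, and \<open>y - \<mu>\<close> has variation at most \<open>n\<close> only on a large event.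
\<close>

locale grid_decomposition = prob_space P + complete_measure P for P :: "'a measure" +
  fixes G :: "nat \<Rightarrow> 'a measure"
    and y \<mu> :: "nat \<Rightarrow> 'a \<Rightarrow> 'h::{real_inner, complete_space}"
    and n c :: real
  assumes subalg: "\<And>i. subalgebra P (G i)"
    and null_sets_subset: "\<And>i. null_sets P \<subseteq> sets (G i)"
    and sets_mono: "\<And>i j. i \<le> j \<Longrightarrow> sets (G i) \<subseteq> sets (G j)"
    and y_adapted: "\<And>i. strongly_measurable P (G i) (y i)"
    and y_0: "\<And>\<omega>. y 0 \<omega> = 0"
    and \<mu>_0: "\<And>\<omega>. \<omega> \<in> space P \<Longrightarrow> \<mu> 0 \<omega> = 0"
    and \<mu>_mart: "\<And>i j. i \<le> j \<Longrightarrow> is_cond_exp P (G i) (\<mu> j) (\<mu> i)"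
    and n_nonneg: "0 \<le> n" and c_nonneg: "0 \<le> c"
begin

sublocale sub: augmented_subalgebra P "G i" for i
  using subalg null_sets_subset by unfold_locales

lemma augmented_subalgebra_P: "augmented_subalgebra P P"
  by (rule augmented_subalgebra_self) (rule complete_measure_axioms)

lemma strongly_measurable_P: "strongly_measurable P (G i) f \<Longrightarrow> strongly_measurable P P f"
  using sub.strongly_measurable_enlarge[of i f P] sub.sets_subset by blast

lemma strongly_measurable_later: "i \<le> j \<Longrightarrow> strongly_measurable P (G i) f \<Longrightarrow> strongly_measurable P (G j) f"
  using sub.strongly_measurable_enlarge[of i f "G j"] sets_mono sub.space_eq by blast

lemma \<mu>_adapted: "strongly_measurable P (G i) (\<mu> i)"
  using \<mu>_mart[of i i] by (simp add: is_cond_exp_def)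

lemma \<mu>_test:
  assumes "i \<le> j" "strongly_measurable P (G i) W" "\<And>\<omega>. \<omega> \<in> space P \<Longrightarrow> norm (W \<omega>) \<le> b"
  shows "(\<integral>\<omega>. W \<omega> \<bullet> \<mu> j \<omega> \<partial>P) = (\<integral>\<omega>. W \<omega> \<bullet> \<mu> i \<omega> \<partial>P)"
  using sub.is_cond_exp_inner(3)[OF \<mu>_mart[OF assms(1)] strongly_measurable_P[OF \<mu>_adapted] assms(2,3)] by simp

lemma \<mu>_integrable: "integrable P (\<lambda>\<omega>. norm (\<mu> i \<omega>))"
  by (rule sub.is_cond_exp_inner(1)[OF \<mu>_mart[OF order.refl] strongly_measurable_P[OF \<mu>_adapted]
        sub.strongly_measurable_const[of i 0], of 0]) simp

lemma inner_integrable: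
  assumes "strongly_measurable P P W" "\<And>\<omega>. \<omega> \<in> space P \<Longrightarrow> norm (W \<omega>) \<le> b"
    and "strongly_measurable P P u" "integrable P (\<lambda>\<omega>. norm (u \<omega>))"
  shows "integrable P (\<lambda>\<omega>. W \<omega> \<bullet> (u \<omega> :: 'h))"
proof (rule Bochner_Integration.integrable_bound)
  show "integrable P (\<lambda>\<omega>. b * norm (u \<omega>))" using assms by simp
  show "(\<lambda>\<omega>. W \<omega> \<bullet> u \<omega>) \<in> borel_measurable P"
    using assms(1,3) by (rule augmented_subalgebra.borel_measurable_inner_strong[OF augmented_subalgebra_P])
  show "AE \<omega> in P. norm (W \<omega> \<bullet> u \<omega>) \<le> norm (b * norm (u \<omega>))"
  proof (rule AE_I2)
    fix \<omega> assume \<omega>: "\<omega> \<in> space P"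
    have "norm (W \<omega> \<bullet> u \<omega>) \<le> norm (W \<omega>) * norm (u \<omega>)" by (simp add: Cauchy_Schwarz_ineq2)
    also have "\<dots> \<le> b * norm (u \<omega>)" using assms(2)[OF \<omega>] by (intro mult_right_mono) auto
    finally show "norm (W \<omega> \<bullet> u \<omega>) \<le> norm (b * norm (u \<omega>))" by simp
  qed
qed

text \<open>
  The norm of a martingale is a submartingale: test with the direction \<open>\<mu>\<^sub>i / \<bar>\<mu>\<^sub>i\<bar>\<close>.
\<close>

lemma \<mu>_norm_mono:
  assumes "i \<le> j" and A: "A \<in> sets (G i)"
  shows "(\<integral>\<omega>. indicator A \<omega> * norm (\<mu> i \<omega>) \<partial>P) \<le> (\<integral>\<omega>. indicator A \<omega> * norm (\<mu> j \<omega>) \<partial>P)"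
proof -
  define W where "W \<omega> = (indicator A \<omega> / norm (\<mu> i \<omega>)) *\<^sub>R \<mu> i \<omega>" for \<omega>
  have W: "strongly_measurable P (G i) W"
    unfolding W_def using sub.borel_measurable_norm_strong[OF \<mu>_adapted] A \<mu>_adapted
    by (intro sub.strongly_measurable_scaleR borel_measurable_divide) auto
  have W_le: "norm (W \<omega>) \<le> indicator A \<omega>" for \<omega>
    by (simp add: W_def split: split_indicator)
  have W_1: "norm (W \<omega>) \<le> 1" for \<omega>
    using W_le[of \<omega>] by (rule order_trans) (simp split: split_indicator)
  have A_P: "A \<in> sets P" using A by (rule sub.sets_subset)
  have "(\<integral>\<omega>. indicator A \<omega> * norm (\<mu> i \<omega>) \<partial>P) = (\<integral>\<omega>. W \<omega> \<bullet> \<mu> i \<omega> \<partial>P)"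
    by (intro Bochner_Integration.integral_cong)
      (auto simp: W_def dot_square_norm power2_eq_square split: split_indicator)
  also have "\<dots> = (\<integral>\<omega>. W \<omega> \<bullet> \<mu> j \<omega> \<partial>P)"
    using \<mu>_test[OF assms(1) W W_1] by simp
  also have "\<dots> \<le> (\<integral>\<omega>. indicator A \<omega> * norm (\<mu> j \<omega>) \<partial>P)"
  proof (rule integral_mono)
    show "integrable P (\<lambda>\<omega>. W \<omega> \<bullet> \<mu> j \<omega>)"
      by (rule inner_integrable[OF strongly_measurable_P[OF W] W_1 strongly_measurable_P[OF \<mu>_adapted] \<mu>_integrable])
    show "integrable P (\<lambda>\<omega>. indicator A \<omega> * norm (\<mu> j \<omega>))"
      using integrable_mult_indicator[OF A_P \<mu>_integrable] by simp
    show "W \<omega> \<bullet> \<mu> j \<omega> \<le> indicator A \<omega> * norm (\<mu> j \<omega>)" for \<omega>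
      using norm_cauchy_schwarz[of "W \<omega>" "\<mu> j \<omega>"] W_le[of \<omega>]
      by (meson mult_right_mono norm_ge_zero order_trans)
  qed
  finally show ?thesis .
qed

definition remainder :: "nat \<Rightarrow> 'a \<Rightarrow> 'h" where
  "remainder i \<omega> = y i \<omega> - \<mu> i \<omega>"

definition controlled :: "nat \<Rightarrow> 'a set" where
  "controlled i = {\<omega>\<in>space P. (\<forall>j\<le>i. norm (y j \<omega>) \<le> c) \<and> (\<Sum>k<i. norm (remainder (Suc k) \<omega> - remainder k \<omega>)) \<le> n}"

text \<open>
  The indicator looks at the end of the step. Hence the step in which the process leaves the controlled region is
  suppressed, and with it a possible overshoot of uncontrolled size. The increment is
  still known at its right end point.
\<close>

definition truncated_increment :: "nat \<Rightarrow> 'a \<Rightarrow> 'h" where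
  "truncated_increment i \<omega> = indicator (controlled (Suc i)) \<omega> *\<^sub>R (y (Suc i) \<omega> - y i \<omega>)"

lemma remainder_adapted: "strongly_measurable P (G i) (remainder i)"
  unfolding remainder_def by (rule sub.strongly_measurable_diff[OF y_adapted \<mu>_adapted])

lemma controlled_sets: "controlled i \<in> sets (G i)"
proof -
  have [measurable]: "(\<lambda>\<omega>. norm (y j \<omega>)) \<in> borel_measurable (G i)" if "j \<le> i" for j
    using that by (intro sub.borel_measurable_norm_strong strongly_measurable_later[OF _ y_adapted])
  have [measurable]: "(\<lambda>\<omega>. norm (remainder (Suc k) \<omega> - remainder k \<omega>)) \<in> borel_measurable (G i)" if "k < i" for k
    using that by (intro sub.borel_measurable_norm_strong sub.strongly_measurable_diff strongly_measurable_later[OF _ remainder_adapted]) auto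
  have 1: "(\<Inter>j\<in>{..i}. {\<omega>\<in>space (G i). norm (y j \<omega>) \<le> c}) \<in> sets (G i)"
    by (intro sets.finite_INT) auto
  have "(\<lambda>\<omega>. \<Sum>k<i. norm (remainder (Suc k) \<omega> - remainder k \<omega>)) \<in> borel_measurable (G i)"
    by (intro borel_measurable_sum) auto
  then have 2: "{\<omega>\<in>space (G i). (\<Sum>k<i. norm (remainder (Suc k) \<omega> - remainder k \<omega>)) \<le> n} \<in> sets (G i)"
    by measurable
  have "controlled i = (\<Inter>j\<in>{..i}. {\<omega>\<in>space (G i). norm (y j \<omega>) \<le> c}) \<inter>
      {\<omega>\<in>space (G i). (\<Sum>k<i. norm (remainder (Suc k) \<omega> - remainder k \<omega>)) \<le> n}"
    by (auto simp: controlled_def sub.space_eq)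
  then show ?thesis using 1 2 by auto
qed

lemma controlled_antimono: "i \<le> j \<Longrightarrow> controlled j \<subseteq> controlled i"
proof -
  assume "i \<le> j"
  then have "(\<Sum>k<i. norm (remainder (Suc k) \<omega> - remainder k \<omega>)) \<le> (\<Sum>k<j. norm (remainder (Suc k) \<omega> - remainder k \<omega>))" for \<omega>
    by (intro sum_mono2) auto
  then show ?thesis using \<open>i \<le> j\<close> unfolding controlled_def by (auto intro: order_trans)
qed

lemma truncated_increment_adapted: "strongly_measurable P (G (Suc i)) (truncated_increment i)"
  unfolding truncated_increment_def using controlled_sets[of "Suc i"]
  by (intro sub.strongly_measurable_scaleR sub.strongly_measurable_diff y_adapted
      strongly_measurable_later[OF _ y_adapted, of i]) auto

lemma truncated_increment_bounded: "norm (truncated_increment i \<omega>) \<le> 2 * c"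
proof (cases "\<omega> \<in> controlled (Suc i)")
  case True
  then have "norm (y (Suc i) \<omega>) \<le> c" "norm (y i \<omega>) \<le> c" by (auto simp: controlled_def)
  then show ?thesis using True norm_triangle_ineq4[of "y (Suc i) \<omega>" "y i \<omega>"] by (simp add: truncated_increment_def)
qed (use c_nonneg in \<open>auto simp: truncated_increment_def\<close>)

lemma norm_truncated_increment_measurable:
  "(\<lambda>\<omega>. norm (truncated_increment i \<omega>)) \<in> borel_measurable P"
  by (rule augmented_subalgebra.borel_measurable_norm_strong[OF augmented_subalgebra_P strongly_measurable_P[OF truncated_increment_adapted]])

lemma norm_truncated_increment_integrable: "integrable P (\<lambda>\<omega>. norm (truncated_increment i \<omega>))"
  using norm_truncated_increment_measurable truncated_increment_bounded
  by (intro integrable_const_bound[where B="2 * c"]) auto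

definition quasimartingale_const :: "nat \<Rightarrow> real" where
  "quasimartingale_const N = c + 2 * n + (\<integral>\<omega>. norm (\<mu> N \<omega>) \<partial>P)"

lemma truncated_variation_le: "(\<Sum>i<N. indicator (controlled (Suc i)) \<omega> * norm (remainder (Suc i) \<omega> - remainder i \<omega>)) \<le> n"
proof (induction N)
  case (Suc N)
  show ?case
  proof (cases "\<omega> \<in> controlled (Suc N)")
    case True
    have "(\<Sum>i<Suc N. indicator (controlled (Suc i)) \<omega> * norm (remainder (Suc i) \<omega> - remainder i \<omega>))
        \<le> (\<Sum>i<Suc N. norm (remainder (Suc i) \<omega> - remainder i \<omega>))"
      by (intro sum_mono) (auto split: split_indicator)
    also have "\<dots> \<le> n" using True unfolding controlled_def by blast
    finally show ?thesis .
  qed (use Suc in auto)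
qed (use n_nonneg in auto)

text \<open>
  Before the exit, the martingale is the difference of a bounded process and one of bounded variation. This controls its value
  just before the exit, which is not a stopping time.
\<close>

lemma \<mu>_bounded_on_controlled:
  assumes "\<omega> \<in> controlled i" shows "norm (\<mu> i \<omega>) \<le> c + n"
proof -
  have "\<omega> \<in> space P" using assms by (auto simp: controlled_def)
  then have "norm (remainder i \<omega>) = norm (\<Sum>k<i. remainder (Suc k) \<omega> - remainder k \<omega>)"
    by (subst sum_lessThan_telescope) (simp add: remainder_def y_0 \<mu>_0)
  also have "\<dots> \<le> n"
    using assms norm_sum[of "\<lambda>k. remainder (Suc k) \<omega> - remainder k \<omega>" "{..<i}"] unfolding controlled_def by auto
  finally have "norm (remainder i \<omega>) \<le> n" .
  moreover have "norm (y i \<omega>) \<le> c" using assms by (auto simp: controlled_def)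
  moreover have "\<mu> i \<omega> = y i \<omega> - remainder i \<omega>" by (simp add: remainder_def)
  ultimately show ?thesis using norm_triangle_ineq4[of "y i \<omega>" "remainder i \<omega>"] by simp
qed

text \<open>
  Suppressing only the steps after the exit would leave a martingale transform of \<open>\<mu>\<close>, whose expectation is
  zero. What remains is the bounded variation part up to the exit, which contributes at most \<open>b n\<close>, and
  the increment of \<open>\<mu>\<close> in the exit step. The left value of this increment is at
  most \<open>c + n\<close>; the right value is \<open>\<mu>\<close> at a stopping time, so its norm has at most the mean of \<open>\<bar>\<mu>\<^sub>N\<bar>\<close>.
\<close>

lemma quasimartingale_bound:
  assumes W: "\<And>i. strongly_measurable P (G i) (W i)"
    and W_le: "\<And>i \<omega>. \<omega> \<in> space P \<Longrightarrow> norm (W i \<omega>) \<le> b" and b: "0 \<le> b"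
  shows "\<bar>\<integral>\<omega>. (\<Sum>i<N. W i \<omega> \<bullet> truncated_increment i \<omega>) \<partial>P\<bar> \<le> b * quasimartingale_const N"
proof -
  \<comment> \<open>the indicator of the event that the exit happens in step \<open>i\<close>, written as a telescoping difference\<close>
  define e where "e i \<omega> = (indicator (controlled i) \<omega> - indicator (controlled (Suc i)) \<omega> :: real)" for i \<omega>
  have e_nonneg: "0 \<le> e i \<omega>" for i \<omega>
    using controlled_antimono[of i "Suc i"] by (auto simp: e_def split: split_indicator)
  have e_eq: "e i \<omega> = indicator (controlled i - controlled (Suc i)) \<omega>" for i \<omega>
    using controlled_antimono[of i "Suc i"] by (auto simp: e_def split: split_indicator)
  have e_sum: "(\<Sum>i<N. e i \<omega>) \<le> 1" for \<omega>
    unfolding e_def by (subst sum_lessThan_telescope') (auto split: split_indicator)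
  have exit_set: "controlled i - controlled (Suc i) \<in> sets (G (Suc i))" for i
    using controlled_sets[of "Suc i"] controlled_sets[of i] sets_mono[of i "Suc i"] by auto
  let ?\<Delta> = "\<lambda>i \<omega>. \<mu> (Suc i) \<omega> - \<mu> i \<omega>"
  \<comment> \<open>the martingale transform that includes the exit step\<close>
  define m where "m \<omega> = (\<Sum>i<N. (indicator (controlled i) \<omega> *\<^sub>R W i \<omega>) \<bullet> ?\<Delta> i \<omega>)" for \<omega>
  define r where "r \<omega> = (\<Sum>i<N. W i \<omega> \<bullet> truncated_increment i \<omega>) - m \<omega>" for \<omega>
  have RW: "strongly_measurable P (G i) (\<lambda>\<omega>. indicator (controlled i) \<omega> *\<^sub>R W i \<omega>)" for i
    using controlled_sets W by (intro sub.strongly_measurable_scaleR) auto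
  have RW_le: "norm (indicator (controlled i) \<omega> *\<^sub>R W i \<omega>) \<le> b" if "\<omega> \<in> space P" for i \<omega>
    using W_le[OF that, of i] b by (auto split: split_indicator)
  have term_int: "integrable P (\<lambda>\<omega>. (indicator (controlled i) \<omega> *\<^sub>R W i \<omega>) \<bullet> \<mu> j \<omega>)" for i j
    by (rule inner_integrable[OF strongly_measurable_P[OF RW] RW_le strongly_measurable_P[OF \<mu>_adapted] \<mu>_integrable])
  have m_int: "integrable P m"
    unfolding m_def inner_diff_right using term_int by (intro Bochner_Integration.integrable_sum Bochner_Integration.integrable_diff)
  have "(\<integral>\<omega>. m \<omega> \<partial>P) = (\<Sum>i<N. (\<integral>\<omega>. (indicator (controlled i) \<omega> *\<^sub>R W i \<omega>) \<bullet> \<mu> (Suc i) \<omega> \<partial>P)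
      - (\<integral>\<omega>. (indicator (controlled i) \<omega> *\<^sub>R W i \<omega>) \<bullet> \<mu> i \<omega> \<partial>P))"
    unfolding m_def inner_diff_right using term_int
    by (subst Bochner_Integration.integral_sum) (auto simp del: inner_scaleR_left intro!: sum.cong)
  also have "\<dots> = 0"
    using \<mu>_test[OF le_SucI[OF order.refl] RW RW_le] by simp
  finally have m_0: "(\<integral>\<omega>. m \<omega> \<partial>P) = 0" .
  have sum_int: "integrable P (\<lambda>\<omega>. \<Sum>i<N. W i \<omega> \<bullet> truncated_increment i \<omega>)"
    by (intro Bochner_Integration.integrable_sum inner_integrable[OF strongly_measurable_P[OF W] W_le strongly_measurable_P[OF truncated_increment_adapted]]
        norm_truncated_increment_integrable)
  have r_int: "integrable P r" unfolding r_def using sum_int m_int by simp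
  have r_eq: "r \<omega> = (\<Sum>i<N. indicator (controlled (Suc i)) \<omega> * (W i \<omega> \<bullet> (remainder (Suc i) \<omega> - remainder i \<omega>)) - e i \<omega> * (W i \<omega> \<bullet> ?\<Delta> i \<omega>))" for \<omega>
    unfolding r_def m_def sum_subtractf[symmetric]
    by (intro sum.cong) (auto simp: e_def truncated_increment_def remainder_def algebra_simps inner_diff_right inner_add_right)
  define q where "q \<omega> = (\<Sum>i<N. e i \<omega> * norm (\<mu> (Suc i) \<omega>))" for \<omega>
  have r_le: "\<bar>r \<omega>\<bar> \<le> b * (c + 2 * n) + b * q \<omega>" if \<omega>: "\<omega> \<in> space P" for \<omega>
  proof -
    have 1: "\<bar>W i \<omega> \<bullet> u\<bar> \<le> b * norm u" for i u
      using Cauchy_Schwarz_ineq2[of "W i \<omega>" u] W_le[OF \<omega>, of i]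
      by (meson mult_right_mono norm_ge_zero order_trans)
    have 2: "e i \<omega> * norm (\<mu> i \<omega>) \<le> e i \<omega> * (c + n)" for i
    proof (cases "\<omega> \<in> controlled i")
      case True then show ?thesis using \<mu>_bounded_on_controlled e_nonneg by (intro mult_left_mono) auto
    qed (simp add: e_eq)
    have "\<bar>r \<omega>\<bar> \<le> (\<Sum>i<N. \<bar>indicator (controlled (Suc i)) \<omega> * (W i \<omega> \<bullet> (remainder (Suc i) \<omega> - remainder i \<omega>)) - e i \<omega> * (W i \<omega> \<bullet> ?\<Delta> i \<omega>)\<bar>)"
      unfolding r_eq by (rule sum_abs)
    also have "\<dots> \<le> (\<Sum>i<N. b * (indicator (controlled (Suc i)) \<omega> * norm (remainder (Suc i) \<omega> - remainder i \<omega>))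
        + (b * (e i \<omega> * (c + n)) + b * (e i \<omega> * norm (\<mu> (Suc i) \<omega>))))"
    proof (rule sum_mono)
      fix i
      have "\<bar>indicator (controlled (Suc i)) \<omega> * (W i \<omega> \<bullet> (remainder (Suc i) \<omega> - remainder i \<omega>)) - e i \<omega> * (W i \<omega> \<bullet> ?\<Delta> i \<omega>)\<bar>
         \<le> indicator (controlled (Suc i)) \<omega> * \<bar>W i \<omega> \<bullet> (remainder (Suc i) \<omega> - remainder i \<omega>)\<bar> + e i \<omega> * \<bar>W i \<omega> \<bullet> ?\<Delta> i \<omega>\<bar>"
        using abs_triangle_ineq4[of "indicator (controlled (Suc i)) \<omega> * (W i \<omega> \<bullet> (remainder (Suc i) \<omega> - remainder i \<omega>))" "e i \<omega> * (W i \<omega> \<bullet> ?\<Delta> i \<omega>)"]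
          e_nonneg[of i \<omega>] by (simp add: abs_mult)
      also have "\<dots> \<le> indicator (controlled (Suc i)) \<omega> * (b * norm (remainder (Suc i) \<omega> - remainder i \<omega>))
          + e i \<omega> * (b * (norm (\<mu> i \<omega>) + norm (\<mu> (Suc i) \<omega>)))"
      proof (intro add_mono mult_left_mono 1 e_nonneg)
        show "\<bar>W i \<omega> \<bullet> ?\<Delta> i \<omega>\<bar> \<le> b * (norm (\<mu> i \<omega>) + norm (\<mu> (Suc i) \<omega>))"
          using norm_triangle_ineq4[of "\<mu> (Suc i) \<omega>" "\<mu> i \<omega>"] b
          by (intro order_trans[OF 1] mult_left_mono) auto
      qed auto
      also have "\<dots> \<le> b * (indicator (controlled (Suc i)) \<omega> * norm (remainder (Suc i) \<omega> - remainder i \<omega>))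
        + (b * (e i \<omega> * (c + n)) + b * (e i \<omega> * norm (\<mu> (Suc i) \<omega>)))"
        using mult_left_mono[OF 2[of i] b] by (simp add: algebra_simps)
      finally show "\<bar>indicator (controlled (Suc i)) \<omega> * (W i \<omega> \<bullet> (remainder (Suc i) \<omega> - remainder i \<omega>)) - e i \<omega> * (W i \<omega> \<bullet> ?\<Delta> i \<omega>)\<bar> \<le> \<dots>" .
    qed
    also have "\<dots> = b * (\<Sum>i<N. indicator (controlled (Suc i)) \<omega> * norm (remainder (Suc i) \<omega> - remainder i \<omega>))
        + (b * ((\<Sum>i<N. e i \<omega>) * (c + n)) + b * q \<omega>)"
      by (simp only: sum.distrib sum_distrib_left sum_distrib_right q_def)
    also have "\<dots> \<le> b * n + (b * (1 * (c + n)) + b * q \<omega>)"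
      using truncated_variation_le e_sum b n_nonneg c_nonneg
      by (intro add_mono mult_left_mono mult_right_mono) auto
    finally show ?thesis by (simp add: algebra_simps)
  qed
  have exit_int: "integrable P (\<lambda>\<omega>. e i \<omega> * norm (\<mu> j \<omega>))" for i j
    unfolding e_eq using integrable_mult_indicator[OF sub.sets_subset[OF exit_set] \<mu>_integrable] by simp
  have q_int: "integrable P q" unfolding q_def using exit_int by (intro Bochner_Integration.integrable_sum)
  have "(\<integral>\<omega>. q \<omega> \<partial>P) = (\<Sum>i<N. \<integral>\<omega>. e i \<omega> * norm (\<mu> (Suc i) \<omega>) \<partial>P)"
    unfolding q_def using exit_int by (rule Bochner_Integration.integral_sum)
  also have "\<dots> \<le> (\<Sum>i<N. \<integral>\<omega>. e i \<omega> * norm (\<mu> N \<omega>) \<partial>P)"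
    unfolding e_eq by (intro sum_mono \<mu>_norm_mono exit_set) auto
  also have "\<dots> = (\<integral>\<omega>. (\<Sum>i<N. e i \<omega>) * norm (\<mu> N \<omega>) \<partial>P)"
    unfolding sum_distrib_right using exit_int by (rule Bochner_Integration.integral_sum[symmetric])
  also have "\<dots> \<le> (\<integral>\<omega>. norm (\<mu> N \<omega>) \<partial>P)"
  proof (rule integral_mono)
    show "integrable P (\<lambda>\<omega>. (\<Sum>i<N. e i \<omega>) * norm (\<mu> N \<omega>))"
      unfolding sum_distrib_right using exit_int by (rule Bochner_Integration.integrable_sum)
    show "(\<Sum>i<N. e i \<omega>) * norm (\<mu> N \<omega>) \<le> norm (\<mu> N \<omega>)" for \<omega>
      using mult_right_mono[OF e_sum, of "norm (\<mu> N \<omega>)"] by simp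
  qed (rule \<mu>_integrable)
  finally have q_le: "(\<integral>\<omega>. q \<omega> \<partial>P) \<le> (\<integral>\<omega>. norm (\<mu> N \<omega>) \<partial>P)" .
  have "(\<integral>\<omega>. (\<Sum>i<N. W i \<omega> \<bullet> truncated_increment i \<omega>) \<partial>P) = (\<integral>\<omega>. r \<omega> \<partial>P)"
    unfolding r_def using sum_int m_int m_0 by simp
  then have "\<bar>\<integral>\<omega>. (\<Sum>i<N. W i \<omega> \<bullet> truncated_increment i \<omega>) \<partial>P\<bar> \<le> (\<integral>\<omega>. \<bar>r \<omega>\<bar> \<partial>P)"
    using integral_abs_bound[of P r] by simp
  also have "\<dots> \<le> (\<integral>\<omega>. b * (c + 2 * n) + b * q \<omega> \<partial>P)"
    using r_int q_int r_le by (intro integral_mono) auto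
  also have "\<dots> = b * (c + 2 * n) + b * (\<integral>\<omega>. q \<omega> \<partial>P)"
    using q_int by (simp add: prob_space)
  also have "\<dots> \<le> b * quasimartingale_const N"
    using mult_left_mono[OF q_le b] by (simp add: quasimartingale_const_def algebra_simps)
  finally show ?thesis .
qed

definition square_const :: "nat \<Rightarrow> real" where
  "square_const N = c\<^sup>2 + 2 * c * quasimartingale_const N"

text \<open>
  The sum of the squares is the square of the process minus twice the sum of \<open>z\<^sub>k \<bullet> D\<^sub>k\<close>, where \<open>z\<close> is the process frozen
  just before the exit. It is bounded by \<open>c\<close> and adapted, hence an admissible weight in the previous bound.
\<close>

lemma square_sum_bound: "(\<integral>\<omega>. (\<Sum>i<N. (norm (truncated_increment i \<omega>))\<^sup>2) \<partial>P) \<le> square_const N"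
proof -
  define z where "z i \<omega> = (\<Sum>k<i. truncated_increment k \<omega>)" for i \<omega>
  have z_adapted: "strongly_measurable P (G i) (z i)" for i
    unfolding z_def by (intro sub.strongly_measurable_sum strongly_measurable_later[OF _ truncated_increment_adapted]) auto
  have z_on_R: "z i \<omega> = y i \<omega>" if "\<omega> \<in> controlled i" for i \<omega>
    using that
  proof (induction i)
    case (Suc i)
    then have "\<omega> \<in> controlled i" using controlled_antimono[of i "Suc i"] by auto
    then show ?case using Suc by (simp add: z_def truncated_increment_def)
  qed (simp add: z_def y_0)
  have z_le: "norm (z i \<omega>) \<le> c" for i \<omega>
  proof (induction i)
    case (Suc i)
    show ?case
    proof (cases "\<omega> \<in> controlled (Suc i)")
      case True
      then show ?thesis using z_on_R[OF True] by (auto simp: controlled_def)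
    next
      case False
      then show ?thesis using Suc by (simp add: z_def truncated_increment_def)
    qed
  qed (simp add: z_def c_nonneg)
  have eq: "(\<Sum>i<N. (norm (truncated_increment i \<omega>))\<^sup>2) = (norm (z N \<omega>))\<^sup>2 - 2 * (\<Sum>i<N. z i \<omega> \<bullet> truncated_increment i \<omega>)" for \<omega>
  proof (induction N)
    case (Suc N)
    have "z (Suc N) \<omega> = z N \<omega> + truncated_increment N \<omega>" by (simp add: z_def)
    then have "(norm (z (Suc N) \<omega>))\<^sup>2 = (norm (z N \<omega>))\<^sup>2 + 2 * (z N \<omega> \<bullet> truncated_increment N \<omega>) + (norm (truncated_increment N \<omega>))\<^sup>2"
      by (simp add: power2_norm_eq_inner inner_add_left inner_add_right inner_commute)
    then show ?case using Suc by simp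
  qed (simp add: z_def)
  have zd_int: "integrable P (\<lambda>\<omega>. \<Sum>i<N. z i \<omega> \<bullet> truncated_increment i \<omega>)"
    by (intro Bochner_Integration.integrable_sum inner_integrable[OF strongly_measurable_P[OF z_adapted] z_le strongly_measurable_P[OF truncated_increment_adapted]
        norm_truncated_increment_integrable])
  have "integrable P (\<lambda>\<omega>. (norm (z N \<omega>))\<^sup>2)"
  proof (rule integrable_const_bound[where B="c\<^sup>2"])
    show "(\<lambda>\<omega>. (norm (z N \<omega>))\<^sup>2) \<in> borel_measurable P"
      using augmented_subalgebra.borel_measurable_norm_strong[OF augmented_subalgebra_P strongly_measurable_P[OF z_adapted]] by simp
  qed (auto intro!: AE_I2 power_mono z_le)
  then have "(\<integral>\<omega>. (\<Sum>i<N. (norm (truncated_increment i \<omega>))\<^sup>2) \<partial>P)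
      = (\<integral>\<omega>. (norm (z N \<omega>))\<^sup>2 \<partial>P) - 2 * (\<integral>\<omega>. (\<Sum>i<N. z i \<omega> \<bullet> truncated_increment i \<omega>) \<partial>P)"
    unfolding eq using zd_int by simp
  moreover have "(\<integral>\<omega>. (norm (z N \<omega>))\<^sup>2 \<partial>P) \<le> c\<^sup>2"
    by (rule integral_le_const) (auto intro!: AE_I2 power_mono z_le \<open>integrable P (\<lambda>\<omega>. (norm (z N \<omega>))\<^sup>2)\<close>)
  moreover have "- 2 * (\<integral>\<omega>. (\<Sum>i<N. z i \<omega> \<bullet> truncated_increment i \<omega>) \<partial>P) \<le> 2 * c * quasimartingale_const N"
    using quasimartingale_bound[OF z_adapted z_le c_nonneg, of N] by simp
  ultimately show ?thesis by (simp add: square_const_def)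
qed

text \<open>
  A bound for the maximum over all partial sums follows from one for the last partial sum, because the sum may be
  stopped: replacing \<open>H\<close> by zero after the first time at which the level \<open>l\<close> is exceeded keeps it
  adapted, and makes the last partial sum as large as the maximum. It also keeps the
  weight \<open>Y H\<close> in the mixed terms of the second moment below \<open>l \<delta>\<close>.
\<close>

lemma maximal_inequality:
  assumes H: "\<And>i. strongly_measurable P (G i) (H i)" and \<delta>: "0 \<le> \<delta>" and l: "0 < l"
  obtains B where "B \<in> sets P" "prob B \<le> (\<delta>\<^sup>2 * square_const N + 2 * l * \<delta> * quasimartingale_const N) / l\<^sup>2"
    and "\<forall>\<omega>\<in>controlled N - B. (\<forall>i<N. norm (H i \<omega>) \<le> \<delta>) \<longrightarrow>
      (\<forall>k\<le>N. \<bar>\<Sum>i<k. H i \<omega> \<bullet> (y (Suc i) \<omega> - y i \<omega>)\<bar> \<le> l)"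
proof -
  define A where "A i = {\<omega>\<in>space P. norm (H i \<omega>) \<le> \<delta>}" for i
  have A: "A i \<in> sets (G i)" for i
    using sub.borel_measurable_norm_strong[OF H, of i] unfolding A_def sub.space_eq[of i, symmetric] by measurable
  define S where "S j \<omega> = (\<Sum>i<j. (indicator (A i) \<omega> *\<^sub>R H i \<omega>) \<bullet> truncated_increment i \<omega>)" for j \<omega>
  have S: "S j \<in> borel_measurable (G j)" for j
    unfolding S_def
  proof (intro borel_measurable_sum sub.borel_measurable_inner_strong)
    fix i assume "i \<in> {..<j}"
    then have "i \<le> j" "Suc i \<le> j" by auto
    then show "strongly_measurable P (G j) (truncated_increment i)" by (intro strongly_measurable_later[OF _ truncated_increment_adapted])
    show "strongly_measurable P (G j) (\<lambda>\<omega>. indicator (A i) \<omega> *\<^sub>R H i \<omega>)"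
      using A H by (intro strongly_measurable_later[OF \<open>i \<le> j\<close>] sub.strongly_measurable_scaleR) auto
  qed
  define E where "E i = {\<omega>\<in>space P. \<forall>j\<le>i. \<bar>S j \<omega>\<bar> \<le> l}" for i
  have E: "E i \<in> sets (G i)" for i
  proof -
    have "{\<omega>\<in>space (G i). \<bar>S j \<omega>\<bar> \<le> l} \<in> sets (G i)" if "j \<le> i" for j
    proof -
      have [measurable]: "S j \<in> borel_measurable (G i)"
        using S[of j] sets_mono[OF that] sub.space_eq by (auto simp: measurable_def)
      show ?thesis by measurable
    qed
    then have "(\<Inter>j\<in>{..i}. {\<omega>\<in>space (G i). \<bar>S j \<omega>\<bar> \<le> l}) \<in> sets (G i)"
      by (intro sets.finite_INT) auto
    also have "(\<Inter>j\<in>{..i}. {\<omega>\<in>space (G i). \<bar>S j \<omega>\<bar> \<le> l}) = E i"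
      by (auto simp: E_def sub.space_eq)
    finally show ?thesis .
  qed
  define U where "U i \<omega> = indicator (A i \<inter> E i) \<omega> *\<^sub>R H i \<omega>" for i \<omega>
  have U: "strongly_measurable P (G i) (U i)" for i
    unfolding U_def using A E H by (intro sub.strongly_measurable_scaleR) auto
  have U_le: "norm (U i \<omega>) \<le> \<delta>" for i \<omega>
    using \<delta> by (auto simp: U_def A_def split: split_indicator)
  define Y where "Y j \<omega> = (\<Sum>i<j. U i \<omega> \<bullet> truncated_increment i \<omega>)" for j \<omega>
  have Y: "Y j \<in> borel_measurable (G j)" for j
    unfolding Y_def
    by (intro borel_measurable_sum sub.borel_measurable_inner_strong strongly_measurable_later[OF _ U] strongly_measurable_later[OF _ truncated_increment_adapted]) auto
  have Y_on_E: "Y i \<omega> = S i \<omega>" if "\<And>j. j < i \<Longrightarrow> \<omega> \<in> E j" for i \<omega>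
    unfolding Y_def S_def using that by (intro sum.cong) (auto simp: U_def split: split_indicator)
  \<comment> \<open>\<open>U\<close> vanishes once \<open>Y\<close> has exceeded the level, so the overshoot of \<open>Y\<close> does not enter.\<close>
  have YU_le: "norm (Y i \<omega> *\<^sub>R U i \<omega>) \<le> l * \<delta>" for i \<omega>
  proof (cases "\<omega> \<in> E i")
    case True
    then have "Y i \<omega> = S i \<omega>" by (intro Y_on_E) (auto simp: E_def)
    then have "\<bar>Y i \<omega>\<bar> \<le> l" using True by (auto simp: E_def)
    then show ?thesis using U_le[of i \<omega>] l \<delta> by (auto intro!: mult_mono)
  qed (use l \<delta> in \<open>simp add: U_def\<close>)
  have Y_sq: "(Y N \<omega>)\<^sup>2 = (\<Sum>i<N. (U i \<omega> \<bullet> truncated_increment i \<omega>)\<^sup>2) + 2 * (\<Sum>i<N. (Y i \<omega> *\<^sub>R U i \<omega>) \<bullet> truncated_increment i \<omega>)" for \<omega>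
    by (induction N) (auto simp: Y_def power2_eq_square algebra_simps)
  note [measurable] = norm_truncated_increment_measurable
  have d2_int: "integrable P (\<lambda>\<omega>. (norm (truncated_increment i \<omega>))\<^sup>2)" for i
    using power_mono[OF truncated_increment_bounded norm_ge_zero, where n=2]
    by (intro integrable_const_bound[where B="(2 * c)\<^sup>2"]) auto
  have YU: "strongly_measurable P (G i) (\<lambda>\<omega>. Y i \<omega> *\<^sub>R U i \<omega>)" for i
    using Y U by (rule sub.strongly_measurable_scaleR)
  have cross_int: "integrable P (\<lambda>\<omega>. \<Sum>i<N. (Y i \<omega> *\<^sub>R U i \<omega>) \<bullet> truncated_increment i \<omega>)"
    by (intro Bochner_Integration.integrable_sum inner_integrable[OF strongly_measurable_P[OF YU] YU_le strongly_measurable_P[OF truncated_increment_adapted]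
        norm_truncated_increment_integrable])
  have Ud_le: "(U i \<omega> \<bullet> truncated_increment i \<omega>)\<^sup>2 \<le> \<delta>\<^sup>2 * (norm (truncated_increment i \<omega>))\<^sup>2" for i \<omega>
  proof -
    have "\<bar>U i \<omega> \<bullet> truncated_increment i \<omega>\<bar> \<le> \<delta> * norm (truncated_increment i \<omega>)"
      using Cauchy_Schwarz_ineq2[of "U i \<omega>" "truncated_increment i \<omega>"] U_le[of i \<omega>]
      by (meson mult_right_mono norm_ge_zero order_trans)
    then show ?thesis
      by (metis abs_ge_zero power2_abs power_mono power_mult_distrib)
  qed
  have Ud_int: "integrable P (\<lambda>\<omega>. (U i \<omega> \<bullet> truncated_increment i \<omega>)\<^sup>2)" for i
  proof (rule Bochner_Integration.integrable_bound)
    show "integrable P (\<lambda>\<omega>. \<delta>\<^sup>2 * (norm (truncated_increment i \<omega>))\<^sup>2)" using d2_int by simp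
    show "(\<lambda>\<omega>. (U i \<omega> \<bullet> truncated_increment i \<omega>)\<^sup>2) \<in> borel_measurable P"
      using augmented_subalgebra.borel_measurable_inner_strong[OF augmented_subalgebra_P strongly_measurable_P[OF U] strongly_measurable_P[OF truncated_increment_adapted]] by simp
  qed (use Ud_le in auto)
  have Y2_int: "integrable P (\<lambda>\<omega>. (Y N \<omega>)\<^sup>2)"
    unfolding Y_sq using Ud_int cross_int by (intro Bochner_Integration.integrable_add Bochner_Integration.integrable_sum) auto
  have "(\<integral>\<omega>. (Y N \<omega>)\<^sup>2 \<partial>P) = (\<integral>\<omega>. (\<Sum>i<N. (U i \<omega> \<bullet> truncated_increment i \<omega>)\<^sup>2) \<partial>P)
      + 2 * (\<integral>\<omega>. (\<Sum>i<N. (Y i \<omega> *\<^sub>R U i \<omega>) \<bullet> truncated_increment i \<omega>) \<partial>P)"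
    unfolding Y_sq using Ud_int cross_int
    by (subst Bochner_Integration.integral_add) (auto intro!: Bochner_Integration.integrable_sum simp del: inner_scaleR_left)
  moreover have "(\<integral>\<omega>. (\<Sum>i<N. (U i \<omega> \<bullet> truncated_increment i \<omega>)\<^sup>2) \<partial>P) \<le> (\<integral>\<omega>. \<delta>\<^sup>2 * (\<Sum>i<N. (norm (truncated_increment i \<omega>))\<^sup>2) \<partial>P)"
    using Ud_int d2_int Ud_le unfolding sum_distrib_left
    by (intro integral_mono Bochner_Integration.integrable_sum sum_mono) auto
  moreover have "(\<integral>\<omega>. \<delta>\<^sup>2 * (\<Sum>i<N. (norm (truncated_increment i \<omega>))\<^sup>2) \<partial>P) \<le> \<delta>\<^sup>2 * square_const N"
    using mult_left_mono[OF square_sum_bound[of N], of "\<delta>\<^sup>2"] by simp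
  moreover have "(\<integral>\<omega>. (\<Sum>i<N. (Y i \<omega> *\<^sub>R U i \<omega>) \<bullet> truncated_increment i \<omega>) \<partial>P) \<le> l * \<delta> * quasimartingale_const N"
    using quasimartingale_bound[OF YU YU_le, of N] l \<delta> by simp
  ultimately have moment: "(\<integral>\<omega>. (Y N \<omega>)\<^sup>2 \<partial>P) \<le> \<delta>\<^sup>2 * square_const N + 2 * l * \<delta> * quasimartingale_const N" by simp
  define B where "B = {\<omega>\<in>space P. l\<^sup>2 \<le> (Y N \<omega>)\<^sup>2}"
  have [measurable]: "Y N \<in> borel_measurable P" using Y by (rule sub.borel_measurable_P)
  show thesis
  proof
    show "B \<in> sets P" unfolding B_def by measurable
    have "prob B \<le> (\<integral>\<omega>. (Y N \<omega>)\<^sup>2 \<partial>P) / l\<^sup>2"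
      unfolding B_def using l by (intro integral_Markov_inequality_measure[OF Y2_int, where A="{}"]) auto
    also have "\<dots> \<le> (\<delta>\<^sup>2 * square_const N + 2 * l * \<delta> * quasimartingale_const N) / l\<^sup>2"
      using moment by (intro divide_right_mono) auto
    finally show "prob B \<le> (\<delta>\<^sup>2 * square_const N + 2 * l * \<delta> * quasimartingale_const N) / l\<^sup>2" .
    show "\<forall>\<omega>\<in>controlled N - B. (\<forall>i<N. norm (H i \<omega>) \<le> \<delta>) \<longrightarrow>
      (\<forall>k\<le>N. \<bar>\<Sum>i<k. H i \<omega> \<bullet> (y (Suc i) \<omega> - y i \<omega>)\<bar> \<le> l)"
    proof (intro ballI impI allI)
      fix \<omega> k assume \<omega>: "\<omega> \<in> controlled N - B" and small: "\<forall>i<N. norm (H i \<omega>) \<le> \<delta>" and k: "k \<le> N"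
      have in_space: "\<omega> \<in> space P" using \<omega> by (auto simp: controlled_def)
      have S_eq: "S j \<omega> = (\<Sum>i<j. H i \<omega> \<bullet> (y (Suc i) \<omega> - y i \<omega>))" if "j \<le> N" for j
        unfolding S_def
      proof (intro sum.cong refl)
        fix i assume "i \<in> {..<j}"
        then have "Suc i \<le> N" using that by auto
        then have "\<omega> \<in> controlled (Suc i)" "\<omega> \<in> A i"
          using controlled_antimono[of "Suc i" N] \<omega> small in_space by (auto simp: A_def)
        then show "(indicator (A i) \<omega> *\<^sub>R H i \<omega>) \<bullet> truncated_increment i \<omega> = H i \<omega> \<bullet> (y (Suc i) \<omega> - y i \<omega>)"
          by (simp add: truncated_increment_def)
      qed
      show "\<bar>\<Sum>i<k. H i \<omega> \<bullet> (y (Suc i) \<omega> - y i \<omega>)\<bar> \<le> l"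
      proof (rule ccontr)
        assume "\<not> ?thesis"
        then have ex: "\<exists>j. j \<le> N \<and> l < \<bar>S j \<omega>\<bar>" using k S_eq[OF k] by (intro exI[of _ k]) auto
        define j where "j = (LEAST j. j \<le> N \<and> l < \<bar>S j \<omega>\<bar>)"
        have j: "j \<le> N" "l < \<bar>S j \<omega>\<bar>" using LeastI_ex[OF ex] by (auto simp: j_def)
        have less: "\<bar>S i \<omega>\<bar> \<le> l" if "i < j" for i
          using not_less_Least[of i "\<lambda>j. j \<le> N \<and> l < \<bar>S j \<omega>\<bar>"] that j(1) by (auto simp: j_def)
        have "Y j \<omega> = S j \<omega>"
          using less in_space by (intro Y_on_E) (auto simp: E_def)
        moreover have "Y N \<omega> = Y j \<omega>"
          unfolding Y_def using j
          by (intro sum.mono_neutral_right) (auto simp: U_def E_def split: split_indicator)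
        ultimately have "l \<le> \<bar>Y N \<omega>\<bar>" using j by simp
        then have "l\<^sup>2 \<le> (Y N \<omega>)\<^sup>2" using l by (metis abs_le_square_iff abs_of_pos)
        then show False using \<omega> in_space by (auto simp: B_def)
      qed
    qed
  qed
qed

end

section \<open>Averaged squared increments as a Riemann--Stieltjes type sum\<close>

text \<open>
  When the right end point \<open>N\<close> moves by one, each of the last \<open>p + 1\<close> squares
  \<open>\<bar>x\<^sub>N - x\<^sub>N\<^sub>-\<^sub>j\<bar>\<^sup>2\<close> changes to \<open>\<bar>x\<^sub>N\<^sub>+\<^sub>1 - x\<^sub>N\<^sub>-\<^sub>j\<bar>\<^sup>2\<close>, and only these. Expanding them gives the new
  summands on the right. Truncated subtraction implements the extension of the sequence by its initial value.
\<close>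

lemma shifted_square_sum:
  fixes x :: "nat \<Rightarrow> 'h::real_inner"
  shows "(\<Sum>i<N. (norm (x (Suc i) - x (i - p)))\<^sup>2) + (\<Sum>j\<le>p. (norm (x N - x (N - j)))\<^sup>2) =
    real (Suc p) * (\<Sum>k<N. (norm (x (Suc k) - x k))\<^sup>2) +
    2 * (\<Sum>k<N. (\<Sum>j\<le>p. x k - x (k - j)) \<bullet> (x (Suc k) - x k))"
proof (induction N)
  case (Suc N)
  let ?d = "x (Suc N) - x N"
  have "(\<Sum>j\<le>p. (norm (x (Suc N) - x (Suc N - j)))\<^sup>2) + (norm (x (Suc N) - x (N - p)))\<^sup>2 =
      (\<Sum>j\<le>Suc p. (norm (x (Suc N) - x (Suc N - j)))\<^sup>2)" by simp
  also have "\<dots> = (\<Sum>j\<le>p. (norm (x (Suc N) - x (N - j)))\<^sup>2)"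
    by (subst sum.atMost_Suc_shift) simp
  also have "\<dots> = (\<Sum>j\<le>p. (norm (x N - x (N - j)))\<^sup>2 + (norm ?d)\<^sup>2 + 2 * ((x N - x (N - j)) \<bullet> ?d))"
    by (intro sum.cong)
      (auto simp: power2_norm_eq_inner inner_diff_left inner_diff_right inner_commute)
  also have "\<dots> = (\<Sum>j\<le>p. (norm (x N - x (N - j)))\<^sup>2) + real (Suc p) * (norm ?d)\<^sup>2
      + 2 * ((\<Sum>j\<le>p. x N - x (N - j)) \<bullet> ?d)"
    by (simp add: sum.distrib inner_sum_left sum_distrib_left)
  finally show ?case using Suc by (simp add: algebra_simps)
qed simp

text \<open>
  Relative to the preceding identity, the sum of the forward squares is shifted by \<open>p = q - 1\<close> indices. This exchanges \<open>p\<close> squares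
  at one end for \<open>p\<close> squares at the other end. These squares, and those in the boundary sum over \<open>j \<le> p\<close>, are at
  most \<open>\<delta>\<^sup>2\<close>, and dividing by \<open>q\<close> compensates their number.
\<close>

lemma averaged_squares_near_quadratic_variation:
  fixes x :: "nat \<Rightarrow> 'h::real_inner"
  assumes q: "0 < q" and osc: "\<And>a b. \<lbrakk>a \<le> b; b \<le> a + q\<rbrakk> \<Longrightarrow> norm (x b - x a) \<le> \<delta>"
  defines "h \<equiv> \<lambda>k. (1 / real q) *\<^sub>R (\<Sum>j<q. x k - x (k - j))"
  shows "norm (h k) \<le> \<delta>"
    and "\<bar>(\<Sum>i<N. (norm (x (i + q) - x i))\<^sup>2) / real q - (\<Sum>i<N. (norm (x (Suc i) - x i))\<^sup>2)\<bar>
      \<le> 2 * \<delta>\<^sup>2 + 2 * \<bar>\<Sum>k<N. h k \<bullet> (x (Suc k) - x k)\<bar>"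
proof -
  have "norm (\<Sum>j<q. x k - x (k - j)) \<le> (\<Sum>j<q. \<delta>)"
    by (rule sum_norm_le) (auto intro: osc)
  then show "norm (h k) \<le> \<delta>" using q by (simp add: h_def field_simps)
  obtain p where p: "q = Suc p" using q by (cases q) auto
  have "0 \<le> \<delta>" using osc[of 0 0] by simp
  define f where "f i = (norm (x (Suc i) - x (i - p)))\<^sup>2" for i
  have f: "0 \<le> f i" "f i \<le> \<delta>\<^sup>2" for i
    unfolding f_def by (auto intro!: power_mono osc simp: p)
  have near: "(norm (x N - x (N - j)))\<^sup>2 \<le> \<delta>\<^sup>2" if "j \<le> p" for j
    using that by (auto intro!: power_mono osc simp: p)
  have shift: "(\<Sum>i<N. f (i + p)) + (\<Sum>i<p. f i) = (\<Sum>i<N. f i) + (\<Sum>i<p. f (i + N))"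
    using sum.atLeastLessThan_concat[of 0 p "N + p" f]
      sum.atLeastLessThan_concat[of 0 N "N + p" f] sum.shift_bounds_nat_ivl[of f 0 p N]
      sum.shift_bounds_nat_ivl[of f 0 N p]
    by (simp add: atLeast0LessThan add.commute)
  have 1: "0 \<le> (\<Sum>i<p. f i)" "(\<Sum>i<p. f i) \<le> real p * \<delta>\<^sup>2"
    "0 \<le> (\<Sum>i<p. f (i + N))" "(\<Sum>i<p. f (i + N)) \<le> real p * \<delta>\<^sup>2"
    using f sum_bounded_above[of "{..<p}" f "\<delta>\<^sup>2"] sum_bounded_above[of "{..<p}" "\<lambda>i. f (i + N)" "\<delta>\<^sup>2"]
    by (auto intro: sum_nonneg)
  have "(\<Sum>j\<le>p. (norm (x N - x (N - j)))\<^sup>2) \<le> real q * \<delta>\<^sup>2"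
    using sum_bounded_above[of "{..p}" "\<lambda>j. (norm (x N - x (N - j)))\<^sup>2" "\<delta>\<^sup>2"] near by (simp add: p)
  moreover have "0 \<le> (\<Sum>j\<le>p. (norm (x N - x (N - j)))\<^sup>2)" by (intro sum_nonneg) auto
  moreover have "real p * \<delta>\<^sup>2 \<le> real q * \<delta>\<^sup>2" by (intro mult_right_mono) (auto simp: p)
  moreover have "(\<Sum>i<N. f i) + (\<Sum>j\<le>p. (norm (x N - x (N - j)))\<^sup>2) =
    real q * (\<Sum>k<N. (norm (x (Suc k) - x k))\<^sup>2) + 2 * (real q * (\<Sum>k<N. h k \<bullet> (x (Suc k) - x k)))"
    using shifted_square_sum[of x p N] q
    by (simp add: f_def h_def p lessThan_Suc_atMost sum_divide_distrib[symmetric])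
  moreover have "(\<Sum>i<N. f (i + p)) = (\<Sum>i<N. (norm (x (i + q) - x i))\<^sup>2)"
    by (simp add: f_def p)
  ultimately have "\<bar>(\<Sum>i<N. (norm (x (i + q) - x i))\<^sup>2) - real q * (\<Sum>k<N. (norm (x (Suc k) - x k))\<^sup>2)
      - 2 * (real q * (\<Sum>k<N. h k \<bullet> (x (Suc k) - x k)))\<bar> \<le> 2 * (real q * \<delta>\<^sup>2)"
    using shift 1 unfolding abs_le_iff by linarith
  then have "\<bar>real q * ((\<Sum>i<N. (norm (x (i + q) - x i))\<^sup>2) / real q - (\<Sum>k<N. (norm (x (Suc k) - x k))\<^sup>2)
      - 2 * (\<Sum>k<N. h k \<bullet> (x (Suc k) - x k)))\<bar> \<le> real q * (2 * \<delta>\<^sup>2)"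
    using q by (simp add: algebra_simps)
  then have "\<bar>(\<Sum>i<N. (norm (x (i + q) - x i))\<^sup>2) / real q - (\<Sum>k<N. (norm (x (Suc k) - x k))\<^sup>2)
      - 2 * (\<Sum>k<N. h k \<bullet> (x (Suc k) - x k))\<bar> \<le> 2 * \<delta>\<^sup>2"
    using q by (simp add: abs_mult)
  then show "\<bar>(\<Sum>i<N. (norm (x (i + q) - x i))\<^sup>2) / real q - (\<Sum>i<N. (norm (x (Suc i) - x i))\<^sup>2)\<bar>
      \<le> 2 * \<delta>\<^sup>2 + 2 * \<bar>\<Sum>k<N. h k \<bullet> (x (Suc k) - x k)\<bar>"
    by linarith
qed

lemma floor_grid_tendsto:
  fixes h :: "nat \<Rightarrow> real"
  assumes h: "\<And>m. 0 < h m" "h \<longlonglongrightarrow> 0" and s: "0 \<le> s"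
  shows "(\<lambda>m. real (nat \<lfloor>s / h m\<rfloor>) * h m) \<longlonglongrightarrow> s"
proof (rule tendsto_sandwich)
  show "(\<lambda>m. s - h m) \<longlonglongrightarrow> s" using tendsto_diff[OF tendsto_const h(2), of s] by simp
  have eq: "real (nat \<lfloor>s / h m\<rfloor>) = of_int \<lfloor>s / h m\<rfloor>" for m
    using s h(1)[of m] by (intro of_nat_nat) simp
  have "s / h m < of_int \<lfloor>s / h m\<rfloor> + 1" for m by linarith
  then show "\<forall>\<^sub>F m in sequentially. s - h m \<le> real (nat \<lfloor>s / h m\<rfloor>) * h m"
    unfolding eq using h(1) by (auto intro!: always_eventually simp: field_simps less_imp_le)
  have "of_int \<lfloor>s / h m\<rfloor> \<le> s / h m" for m by linarith
  then show "\<forall>\<^sub>F m in sequentially. real (nat \<lfloor>s / h m\<rfloor>) * h m \<le> s"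
    unfolding eq pos_le_divide_eq[OF h(1)] by simp
qed auto

text \<open>
  The sum is the integral of a step function, up to a factor that tends to \<open>1 / \<epsilon>\<close>. The step functions converge at every
  point except possibly \<open>t\<close>, and are dominated. Rounding \<open>\<epsilon>\<close> and \<open>t\<close> down to multiples of the mesh makes no difference in the limit.
\<close>

lemma riemann_sum_averaged_squares:
  fixes x :: "real \<Rightarrow> 'h::real_normed_vector"
  assumes cont: "continuous_on UNIV x" and bdd: "\<And>s. norm (x s) \<le> c"
    and h: "\<And>m. 0 < h m" "h \<longlonglongrightarrow> 0" and \<epsilon>: "0 < \<epsilon>" and t: "0 \<le> t"
  defines "q \<equiv> \<lambda>m. nat \<lfloor>\<epsilon> / h m\<rfloor>" and "N \<equiv> \<lambda>m. nat \<lfloor>t / h m\<rfloor>"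
  shows "(\<lambda>m. (\<Sum>i<N m. (norm (x (real (i + q m) * h m) - x (real i * h m)))\<^sup>2) / real (q m))
    \<longlonglongrightarrow> (LINT s:{0..t}|lborel. (norm (x (s + \<epsilon>) - x s))\<^sup>2 / \<epsilon>)"
proof -
  define a where "a m i = (norm (x (real (i + q m) * h m) - x (real i * h m)))\<^sup>2" for m i
  define \<psi> where "\<psi> m s = (\<Sum>i<N m. indicator {real i * h m..<real (Suc i) * h m} s * a m i)" for m s
  define g where "g s = (norm (x (s + \<epsilon>) - x s))\<^sup>2" for s
  have g_cont: "continuous_on UNIV g"
    unfolding g_def by (intro continuous_intros continuous_on_compose2[OF cont]) auto
  have [measurable]: "g \<in> borel_measurable borel"
    by (rule borel_measurable_continuous_onI[OF g_cont])
  have diff_le: "norm (x u - x w) \<le> 2 * c" for u w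
    using norm_triangle_ineq4[of "x u" "x w"] bdd[of u] bdd[of w] by simp
  have a_le: "a m i \<le> (2 * c)\<^sup>2" for m i
    unfolding a_def using diff_le by (intro power_mono) auto
  have cell: "s \<in> {real i * h m..<real (Suc i) * h m} \<longleftrightarrow> i = nat \<lfloor>s / h m\<rfloor>" if "0 \<le> s" for s i m
  proof -
    have "s \<in> {real i * h m..<real (Suc i) * h m} \<longleftrightarrow> real i \<le> s / h m \<and> s / h m < real i + 1"
      using h(1)[of m] by (simp add: field_simps)
    also have "\<dots> \<longleftrightarrow> \<lfloor>s / h m\<rfloor> = int i" by (simp add: floor_eq_iff)
    also have "\<dots> \<longleftrightarrow> i = nat \<lfloor>s / h m\<rfloor>"
      using that h(1)[of m] by (auto simp: eq_nat_nat_iff)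
    finally show ?thesis .
  qed
  have \<psi>_eq: "\<psi> m s = (if 0 \<le> s \<and> nat \<lfloor>s / h m\<rfloor> < N m then a m (nat \<lfloor>s / h m\<rfloor>) else 0)" for m s
  proof (cases "0 \<le> s")
    case True
    have "\<psi> m s = (\<Sum>i<N m. if i = nat \<lfloor>s / h m\<rfloor> then a m i else 0)"
      unfolding \<psi>_def indicator_def cell[OF True] by (intro sum.cong) auto
    then show ?thesis using True by simp
  next
    case False
    have "s \<notin> {real i * h m..<real (Suc i) * h m}" for i
    proof -
      have "0 \<le> real i * h m" using h(1)[of m] by (intro mult_nonneg_nonneg) auto
      then show ?thesis using False by auto
    qed
    then show ?thesis using False unfolding \<psi>_def by simp
  qed
  have "(\<lambda>m. \<integral>s. \<psi> m s \<partial>lborel) \<longlonglongrightarrow> (\<integral>s. indicator {0..t} s * g s \<partial>lborel)"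
  proof (rule integral_dominated_convergence)
    show "integrable lborel (\<lambda>s. indicator {0..t} s * (2 * c)\<^sup>2 :: real)"
      using t by (intro integrable_mult_left) (auto simp: integrable_indicator_iff)
    show "(\<lambda>s. indicator {0..t} s * g s) \<in> borel_measurable lborel" by measurable
    show "\<psi> m \<in> borel_measurable lborel" for m unfolding \<psi>_def by measurable
    show "AE s in lborel. norm (\<psi> m s) \<le> indicator {0..t} s * (2 * c)\<^sup>2" for m
    proof (rule AE_I2)
      fix s
      show "norm (\<psi> m s) \<le> indicator {0..t} s * (2 * c)\<^sup>2"
      proof (cases "0 \<le> s \<and> nat \<lfloor>s / h m\<rfloor> < N m")
        case True
        have "s \<le> t"
        proof (rule ccontr)
          assume "\<not> s \<le> t"
          then have "t / h m \<le> s / h m" using h(1)[of m] by (simp add: divide_right_mono)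
          then have "N m \<le> nat \<lfloor>s / h m\<rfloor>" unfolding N_def by (intro nat_mono floor_mono)
          then show False using True by simp
        qed
        then show ?thesis using True a_le by (simp add: \<psi>_eq) (simp add: a_def)
      qed (auto simp: \<psi>_eq)
    qed
    have "AE s in lborel. s \<noteq> t" by (rule AE_lborel_singleton)
    then show "AE s in lborel. (\<lambda>m. \<psi> m s) \<longlonglongrightarrow> indicator {0..t} s * g s"
    proof eventually_elim
      case (elim s)
      consider "s < 0" | "t < s" | "0 \<le> s" "s < t" using elim by linarith
      then show ?case
      proof cases
        case 1 then show ?thesis by (simp add: \<psi>_eq)
      next
        case 2
        have "\<not> nat \<lfloor>s / h m\<rfloor> < N m" for m
          unfolding not_less N_def using 2 h(1)[of m] by (intro nat_mono floor_mono divide_right_mono) auto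
        then show ?thesis using 2 by (simp add: \<psi>_eq)
      next
        case 3
        have lim_s: "(\<lambda>m. real (nat \<lfloor>s / h m\<rfloor>) * h m) \<longlonglongrightarrow> s"
          using h 3 by (intro floor_grid_tendsto)
        have lim_t: "(\<lambda>m. real (N m) * h m) \<longlonglongrightarrow> t"
          unfolding N_def using h t by (intro floor_grid_tendsto)
        have lim_\<epsilon>: "(\<lambda>m. real (q m) * h m) \<longlonglongrightarrow> \<epsilon>"
          unfolding q_def using h \<epsilon> by (intro floor_grid_tendsto) auto
        have "eventually (\<lambda>m. 0 < real (N m) * h m - real (nat \<lfloor>s / h m\<rfloor>) * h m) sequentially"
          using 3 by (intro order_tendstoD(1)[OF tendsto_diff[OF lim_t lim_s]]) auto
        then have ev: "eventually (\<lambda>m. a m (nat \<lfloor>s / h m\<rfloor>) = \<psi> m s) sequentially"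
        proof eventually_elim
          case (elim m)
          then have "nat \<lfloor>s / h m\<rfloor> < N m" using h(1)[of m] by (simp add: mult_less_cancel_right)
          then show ?case using 3 by (simp add: \<psi>_eq)
        qed
        have x_lim: "(\<lambda>m. x (u m)) \<longlonglongrightarrow> x w" if "u \<longlonglongrightarrow> w" for u w
          using continuous_on_tendsto_compose[OF cont that] by simp
        have "(\<lambda>m. a m (nat \<lfloor>s / h m\<rfloor>)) \<longlonglongrightarrow> g s"
          unfolding a_def g_def of_nat_add distrib_right
          by (intro tendsto_intros x_lim lim_s lim_\<epsilon>)
        then have "(\<lambda>m. \<psi> m s) \<longlonglongrightarrow> g s" using ev by (rule Lim_transform_eventually)
        then show ?thesis using 3 by simp
      qed
    qed
  qed
  moreover have "(\<integral>s. \<psi> m s \<partial>lborel) = h m * (\<Sum>i<N m. a m i)" for m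
  proof -
    have "integrable lborel (\<lambda>s. indicator {real i * h m..<real (Suc i) * h m} s * a m i)" for i
      using h(1)[of m] by (intro integrable_mult_left) (auto simp: integrable_indicator_iff)
    then have "(\<integral>s. \<psi> m s \<partial>lborel) = (\<Sum>i<N m. h m * a m i)"
      unfolding \<psi>_def using h(1)[of m]
      by (subst Bochner_Integration.integral_sum) (auto simp: algebra_simps)
    then show ?thesis by (simp add: sum_distrib_left)
  qed
  ultimately have "(\<lambda>m. h m * (\<Sum>i<N m. a m i)) \<longlonglongrightarrow> (\<integral>s. indicator {0..t} s * g s \<partial>lborel)" by simp
  moreover have "(\<lambda>m. real (q m) * h m) \<longlonglongrightarrow> \<epsilon>"
    unfolding q_def using h \<epsilon> by (intro floor_grid_tendsto) auto
  ultimately have "(\<lambda>m. (h m * (\<Sum>i<N m. a m i)) / (real (q m) * h m))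
      \<longlonglongrightarrow> (\<integral>s. indicator {0..t} s * g s \<partial>lborel) / \<epsilon>"
    using \<epsilon> by (intro tendsto_divide) auto
  also have "(\<lambda>m. (h m * (\<Sum>i<N m. a m i)) / (real (q m) * h m)) = (\<lambda>m. (\<Sum>i<N m. a m i) / real (q m))"
    using h(1) by (auto simp: fun_eq_iff less_imp_neq[symmetric])
  also have "(\<integral>s. indicator {0..t} s * g s \<partial>lborel) / \<epsilon> = (LINT s:{0..t}|lborel. g s / \<epsilon>)"
    unfolding set_lebesgue_integral_def integral_divide_zero[symmetric] by simp
  finally show ?thesis unfolding a_def g_def .
qed

section \<open>Completeness for uniform convergence in probability\<close>

lemma (in prob_space) exhausting_events:
  assumes A: "\<And>k::nat. A k \<in> events" and ev: "AE \<omega> in M. eventually (\<lambda>k. \<omega> \<in> A k) sequentially"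
    and \<eta>: "0 < \<eta>"
  obtains k where "prob (space M - A k) \<le> \<eta>"
proof -
  define B where "B k = (\<Inter>j\<in>{k..}. A j)" for k
  have B: "B k \<in> events" for k unfolding B_def using A by (intro sets.countable_INT) auto
  have "(\<lambda>k. prob (B k)) \<longlonglongrightarrow> prob (\<Union>k. B k)"
    using B by (intro finite_Lim_measure_incseq) (auto simp: B_def incseq_def)
  also have "prob (\<Union>k. B k) = 1"
  proof (rule prob_eq_1[THEN iffD2])
    show "AE \<omega> in M. \<omega> \<in> (\<Union>k. B k)"
      using ev by eventually_elim (auto simp: B_def eventually_sequentially)
  qed (use B in auto)
  finally have "(\<lambda>k. prob (B k)) \<longlonglongrightarrow> 1" .
  then have "eventually (\<lambda>k. 1 - \<eta> < prob (B k)) sequentially"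
    using \<eta> by (intro order_tendstoD) auto
  then obtain k where "1 - \<eta> < prob (B k)" by (auto simp: eventually_sequentially)
  also have "prob (B k) \<le> prob (A k)" using A by (intro finite_measure_mono) (auto simp: B_def)
  finally show thesis using A prob_compl[of "A k"] by (intro that[of k]) simp
qed

text \<open>
  This is Fatou's lemma for events. A point outside of the limes inferior lies outside of infinitely many
  of the exceptional events, which is enough to pass to the limit in an inequality.
\<close>

lemma (in prob_space) liminf_events_le:
  assumes D: "\<And>m::nat. D m \<in> events" and le: "\<And>m. prob (D m) \<le> a"
  shows "(\<Union>k. \<Inter>m\<in>{k..}. D m) \<in> events" "prob (\<Union>k. \<Inter>m\<in>{k..}. D m) \<le> a"
proof -
  have E: "(\<Inter>m\<in>{k..}. D m) \<in> events" for k using D by (intro sets.countable_INT) auto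
  then show "(\<Union>k. \<Inter>m\<in>{k..}. D m) \<in> events" by auto
  have "(\<lambda>k. prob (\<Inter>m\<in>{k..}. D m)) \<longlonglongrightarrow> prob (\<Union>k. \<Inter>m\<in>{k..}. D m)"
    using E by (intro finite_Lim_measure_incseq) (auto simp: incseq_def)
  moreover have "prob (\<Inter>m\<in>{k..}. D m) \<le> a" for k
    by (rule order_trans[OF finite_measure_mono le[of k]]) (use D in auto)
  ultimately show "prob (\<Union>k. \<Inter>m\<in>{k..}. D m) \<le> a"
    by (intro LIMSEQ_le_const2) auto
qed

text \<open>
  Along a sequence \<open>u\<^sub>k\<close> of parameters, consecutive processes differ by at most \<open>2\<^sup>-\<^sup>k\<close> outside of an event \<open>B\<^sub>k\<close> of
  probability at most \<open>2\<^sup>-\<^sup>k\<close>. By Borel--Cantelli almost every path sequence converges uniformly, with an explicit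
  rate outside of the tail union \<open>Z\<^sub>k\<close>. The exceptional events are measurable sets in the hypothesis,
  and so they bound the outer measure in the conclusion.
\<close>

lemma ucp_Cauchy_imp_convergent:
  fixes Y :: "real \<Rightarrow> real \<Rightarrow> 'a \<Rightarrow> real"
  assumes "prob_space P"
    and meas: "\<And>\<epsilon> t. \<lbrakk>0 < \<epsilon>; t \<in> {0..T}\<rbrakk> \<Longrightarrow> Y \<epsilon> t \<in> borel_measurable P"
    and cont: "AE \<omega> in P. \<forall>\<epsilon>>0. continuous_on {0..T} (\<lambda>t. Y \<epsilon> t \<omega>)"
    and Cauchy: "\<And>\<eta>. 0 < \<eta> \<Longrightarrow> \<exists>\<epsilon>\<^sub>0>0. \<forall>\<epsilon>\<in>{0<..<\<epsilon>\<^sub>0}. \<forall>\<epsilon>'\<in>{0<..<\<epsilon>\<^sub>0}. \<exists>B\<in>sets P. measure P B \<le> \<eta> \<and>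
      (\<forall>\<omega>\<in>space P - B. \<forall>t\<in>{0..T}. \<bar>Y \<epsilon> t \<omega> - Y \<epsilon>' t \<omega>\<bar> \<le> \<eta>)"
  obtains Q where "\<forall>t\<in>{0..T}. Q t \<in> borel_measurable P"
    and "continuous_process P T Q" and "ucp_tendsto P T Y Q (at_right 0)"
proof -
  interpret prob_space P by fact
  have "\<exists>\<epsilon>\<^sub>0>0. \<forall>\<epsilon>\<in>{0<..<\<epsilon>\<^sub>0}. \<forall>\<epsilon>'\<in>{0<..<\<epsilon>\<^sub>0}. \<exists>B\<in>sets P. measure P B \<le> (1/2)^k \<and>
      (\<forall>\<omega>\<in>space P - B. \<forall>t\<in>{0..T}. \<bar>Y \<epsilon> t \<omega> - Y \<epsilon>' t \<omega>\<bar> \<le> (1/2)^k)" for k :: nat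
    by (rule Cauchy) simp
  then obtain e where e: "\<And>k. 0 < e k"
    and e_Cauchy: "\<And>k \<epsilon> \<epsilon>'. \<lbrakk>0 < \<epsilon>; \<epsilon> < e k; 0 < \<epsilon>'; \<epsilon>' < e k\<rbrakk> \<Longrightarrow> \<exists>B\<in>sets P. prob B \<le> (1/2)^k \<and>
      (\<forall>\<omega>\<in>space P - B. \<forall>t\<in>{0..T}. \<bar>Y \<epsilon> t \<omega> - Y \<epsilon>' t \<omega>\<bar> \<le> (1/2)^k)"
    using that by (simp only: greaterThanLessThan_iff Ball_def) metis
  \<comment> \<open>The minimum makes \<open>u k\<close> admissible for all thresholds \<open>e j\<close> with \<open>j \<le> k\<close>, the half makes it strictly smaller.\<close>
  define u where "u k = Min (e ` {..k}) / 2" for k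
  have u_pos: "0 < u k" for k using e by (simp add: u_def)
  have u_less: "u k < e j" if "j \<le> k" for j k
  proof -
    have "Min (e ` {..k}) \<le> e j" using that by (intro Min_le) auto
    then show ?thesis using e[of j] by (simp add: u_def)
  qed
  have "\<exists>B. B \<in> sets P \<and> prob B \<le> (1/2)^k \<and>
      (\<forall>\<omega>\<in>space P - B. \<forall>t\<in>{0..T}. \<bar>Y (u k) t \<omega> - Y (u (Suc k)) t \<omega>\<bar> \<le> (1/2)^k)" for k
    using e_Cauchy[OF u_pos u_less u_pos u_less, of k k "Suc k"] by auto
  then obtain B where B: "\<And>k. B k \<in> sets P" "\<And>k. prob (B k) \<le> (1/2)^k"
    and B_Cauchy: "\<And>k \<omega> t. \<lbrakk>\<omega> \<in> space P - B k; t \<in> {0..T}\<rbrakk> \<Longrightarrow> \<bar>Y (u k) t \<omega> - Y (u (Suc k)) t \<omega>\<bar> \<le> (1/2)^k"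
    by metis
  define Z where "Z k = (\<Union>j. B (j + k))" for k
  have Z: "Z k \<in> sets P" for k unfolding Z_def using B by auto
  have Z_le: "prob (Z k) \<le> 2 * (1/2)^k" for k
  proof -
    have geo: "(\<lambda>j. (1/2)^(j + k) :: real) sums (2 * (1/2)^k)"
      using sums_mult2[OF geometric_sums[of "1/2::real"], of "(1/2)^k"] by (simp add: power_add)
    have sm: "summable (\<lambda>j. prob (B (j + k)))"
      by (rule summable_comparison_test'[OF sums_summable[OF geo], of 0]) (use B in auto)
    have "prob (Z k) \<le> (\<Sum>j. prob (B (j + k)))"
      unfolding Z_def using B sm by (intro finite_measure_subadditive_countably) auto
    also have "\<dots> \<le> (\<Sum>j. (1/2)^(j + k))"
      using B sm sums_summable[OF geo] by (intro suminf_le) auto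
    finally show ?thesis using geo by (simp add: sums_iff)
  qed
  define Q where "Q t \<omega> = lim (\<lambda>k. Y (u k) t \<omega>)" for t \<omega>
  have near: "\<bar>Y (u k) t \<omega> - Q t \<omega>\<bar> \<le> 2 * (1/2)^k"
    if \<omega>: "\<omega> \<in> space P - Z k" and t: "t \<in> {0..T}" for k t \<omega>
  proof -
    have step: "\<bar>Y (u j) t \<omega> - Y (u (Suc j)) t \<omega>\<bar> \<le> (1/2)^j" if "k \<le> j" for j
    proof -
      have "B j \<subseteq> Z k" unfolding Z_def using that by (auto intro!: exI[of _ "j - k"])
      then show ?thesis using B_Cauchy[of \<omega> j t] \<omega> t by auto
    qed
    have tail: "\<bar>Y (u i) t \<omega> - Y (u (i + l)) t \<omega>\<bar> \<le> 2 * (1/2)^i" if "k \<le> i" for i l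
    proof -
      have "\<bar>Y (u i) t \<omega> - Y (u (i + l)) t \<omega>\<bar> \<le> 2 * (1/2)^i - 2 * (1/2)^(i + l)"
      proof (induction l)
        case (Suc l)
        show ?case using Suc step[of "i + l"] that by (simp add: abs_le_iff)
      qed simp
      also have "\<dots> \<le> 2 * (1/2)^i" by simp
      finally show ?thesis .
    qed
    have "Cauchy (\<lambda>j. Y (u (j + k)) t \<omega>)"
    proof (rule CauchyI')
      fix r :: real assume "0 < r"
      then obtain i where i: "(1/2)^i < r / 2" using real_arch_pow_inv[of "r/2" "1/2"] by auto
      show "\<exists>M. \<forall>m\<ge>M. \<forall>n>m. dist (Y (u (m + k)) t \<omega>) (Y (u (n + k)) t \<omega>) < r"
      proof (intro exI[of _ i] allI impI)
        fix m n assume "i \<le> m" "m < n"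
        have "dist (Y (u (m + k)) t \<omega>) (Y (u (n + k)) t \<omega>) \<le> 2 * (1/2)^(m + k)"
          using tail[of "m + k" "n - m"] \<open>m < n\<close> by (simp add: dist_real_def add.commute)
        also have "\<dots> \<le> 2 * (1/2)^i" using \<open>i \<le> m\<close> by (intro mult_left_mono power_decreasing) auto
        finally show "dist (Y (u (m + k)) t \<omega>) (Y (u (n + k)) t \<omega>) < r" using i by simp
      qed
    qed
    then obtain L where L: "(\<lambda>j. Y (u (j + k)) t \<omega>) \<longlonglongrightarrow> L"
      using Cauchy_convergent convergentD by blast
    then have "(\<lambda>j. Y (u j) t \<omega>) \<longlonglongrightarrow> L" by (rule LIMSEQ_offset)
    then have "Q t \<omega> = L" unfolding Q_def by (rule limI)
    then have "(\<lambda>j. Y (u (k + j)) t \<omega>) \<longlonglongrightarrow> Q t \<omega>" using L by (simp add: add.commute)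
    then have "(\<lambda>j. \<bar>Y (u k) t \<omega> - Y (u (k + j)) t \<omega>\<bar>) \<longlonglongrightarrow> \<bar>Y (u k) t \<omega> - Q t \<omega>\<bar>"
      by (intro tendsto_intros)
    moreover have "\<bar>Y (u k) t \<omega> - Y (u (k + j)) t \<omega>\<bar> \<le> 2 * (1/2)^k" for j
      by (rule tail) simp
    ultimately show ?thesis by (intro LIMSEQ_le_const2) auto
  qed
  show thesis
  proof
    show "\<forall>t\<in>{0..T}. Q t \<in> borel_measurable P"
      unfolding Q_def using meas[OF u_pos] by (intro ballI borel_measurable_lim_metric)
    have null: "(\<Inter>k. Z k) \<in> null_sets P"
    proof -
      have in_sets: "(\<Inter>k. Z k) \<in> sets P" using Z by auto
      have lim: "(\<lambda>k. 2 * (1/2)^k :: real) \<longlonglongrightarrow> 2 * 0"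
        by (intro tendsto_intros LIMSEQ_realpow_zero) auto
      have "prob (\<Inter>k. Z k) \<le> 2 * (1/2)^k" for k
        by (rule order_trans[OF finite_measure_mono Z_le[of k]]) (use Z in auto)
      then have "prob (\<Inter>k. Z k) \<le> 2 * 0"
        by (intro LIMSEQ_le_const[OF lim] exI[of _ 0] allI impI)
      then have "prob (\<Inter>k. Z k) = 0" by (simp add: measure_le_0_iff)
      then show ?thesis using in_sets by (auto simp: emeasure_eq_measure)
    qed
    show "continuous_process P T Q"
      unfolding continuous_process_def using cont AE_not_in[OF null] AE_space
    proof eventually_elim
      case (elim \<omega>)
      then obtain k where k: "\<omega> \<notin> Z k" by auto
      have lim: "uniform_limit {0..T} (\<lambda>j t. Y (u j) t \<omega>) (\<lambda>t. Q t \<omega>) sequentially"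
      proof (rule uniform_limitI)
        fix r :: real assume "0 < r"
        then obtain i where i: "(1/2)^i < r / 2" using real_arch_pow_inv[of "r/2" "1/2"] by auto
        show "\<forall>\<^sub>F j in sequentially. \<forall>t\<in>{0..T}. dist (Y (u j) t \<omega>) (Q t \<omega>) < r"
          using eventually_ge_at_top[of "max i k"]
        proof eventually_elim
          case (elim j)
          then have j: "i \<le> j" "k \<le> j" by auto
          have "B (l + j) \<subseteq> Z k" for l
            unfolding Z_def using j(2) UN_upper[of "l + j - k" UNIV "\<lambda>l. B (l + k)"] by simp
          then have "Z j \<subseteq> Z k" unfolding Z_def[of j] by blast
          then have \<omega>: "\<omega> \<in> space P - Z j" using k \<open>\<omega> \<in> space P\<close> by auto
          show "\<forall>t\<in>{0..T}. dist (Y (u j) t \<omega>) (Q t \<omega>) < r"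
          proof
            fix t assume t: "t \<in> {0..T}"
            have "dist (Y (u j) t \<omega>) (Q t \<omega>) \<le> 2 * (1/2)^j"
              using near[OF \<omega> t] by (simp add: dist_real_def)
            also have "\<dots> \<le> 2 * (1/2)^i" using j by (simp add: power_decreasing)
            finally show "dist (Y (u j) t \<omega>) (Q t \<omega>) < r" using i by simp
          qed
        qed
      qed
      show ?case
        by (rule uniform_limit_theorem[OF _ lim]) (use elim u_pos in auto)
    qed
    show "ucp_tendsto P T Y Q (at_right 0)"
      unfolding ucp_tendsto_def
    proof (intro allI impI)
      fix \<delta> :: real assume \<delta>: "0 < \<delta>"
      let ?E = "\<lambda>\<epsilon>. {\<omega>\<in>space P. ennreal \<delta> < (SUP t\<in>{0..T}. ennreal \<bar>Y \<epsilon> t \<omega> - Q t \<omega>\<bar>)}"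
      show "((\<lambda>\<epsilon>. outer_measure_of P (?E \<epsilon>)) \<longlongrightarrow> 0) (at_right 0)"
      proof (rule order_tendstoI)
        fix a :: ennreal assume "0 < a"
        obtain r where r: "0 < r" "ennreal r < a"
        proof -
          obtain b where b: "0 < b" "b < a" using dense[OF \<open>0 < a\<close>] by blast
          then have "b \<noteq> \<top>" using top.not_eq_extremum by fastforce
          then show thesis using b that[of "enn2real b"] by (simp add: enn2real_positive_iff less_top)
        qed
        obtain k where k: "(1/2)^k < min \<delta> r / 3"
          using real_arch_pow_inv[of "min \<delta> r / 3" "1/2"] \<delta> r by auto
        have "eventually (\<lambda>\<epsilon>. \<epsilon> \<in> {0<..<e k}) (at_right 0)"
          using e by (intro eventually_at_right_real)
        then show "eventually (\<lambda>\<epsilon>. outer_measure_of P (?E \<epsilon>) < a) (at_right 0)"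
        proof eventually_elim
          case (elim \<epsilon>)
          then obtain D where D: "D \<in> sets P" "prob D \<le> (1/2)^k"
            "\<And>\<omega> t. \<lbrakk>\<omega> \<in> space P - D; t \<in> {0..T}\<rbrakk> \<Longrightarrow> \<bar>Y \<epsilon> t \<omega> - Y (u k) t \<omega>\<bar> \<le> (1/2)^k"
            using e_Cauchy[of \<epsilon> k "u k"] u_pos u_less by auto
          have "?E \<epsilon> \<subseteq> D \<union> Z k"
          proof (rule subsetI, rule ccontr)
            fix \<omega> assume \<omega>: "\<omega> \<in> ?E \<epsilon>" "\<omega> \<notin> D \<union> Z k"
            have "(SUP t\<in>{0..T}. ennreal \<bar>Y \<epsilon> t \<omega> - Q t \<omega>\<bar>) \<le> ennreal \<delta>"
            proof (intro SUP_least ennreal_leI)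
              fix t assume t: "t \<in> {0..T}"
              show "\<bar>Y \<epsilon> t \<omega> - Q t \<omega>\<bar> \<le> \<delta>"
                using D(3)[of \<omega> t] near[of \<omega> k t] \<omega> t k by auto
            qed
            then show False using \<omega> by auto
          qed
          then have "outer_measure_of P (?E \<epsilon>) \<le> outer_measure_of P (D \<union> Z k)"
            by (rule outer_measure_of_mono)
          also have "\<dots> = prob (D \<union> Z k)"
            using D Z by (simp add: emeasure_eq_measure)
          also have "prob (D \<union> Z k) \<le> prob D + prob (Z k)"
            using D Z by (intro measure_Un_le) auto
          also have "\<dots> \<le> r" using D(2) Z_le[of k] k by auto
          finally have "outer_measure_of P (?E \<epsilon>) \<le> ennreal r" by (simp add: ennreal_leI)
          then show ?case using r(2) by (rule order.strict_trans1)
        qed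
      qed auto
    qed
  qed
qed

section \<open>Semimartingales on dyadic grids\<close>

lemma clip_mem: "0 < T \<Longrightarrow> clip T t \<in> {0..T}"
  by (auto simp: clip_def)

lemma clip_idem: "t \<in> {0..T} \<Longrightarrow> clip T t = t"
  by (auto simp: clip_def)

lemma clip_mono: "s \<le> t \<Longrightarrow> clip T s \<le> clip T t"
  by (auto simp: clip_def)

lemma clip_nonexpansive: "\<bar>clip T t - clip T s\<bar> \<le> \<bar>t - s\<bar>"
  by (auto simp: clip_def max_def min_def)

lemma continuous_on_clip: "continuous_on UNIV (clip T)"
  unfolding clip_def by (intro continuous_intros)

text \<open>
  The locale collects the data whose existence the definition of a semimartingale asserts. The paths of \<open>X\<close> are
  continuous, while \<open>M\<close> and \<open>V\<close> may have jumps that cancel each other.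
\<close>

locale semimartingale_decomposition = usual_filtered_prob_space P T F
  for P :: "'a measure" and T :: real and F :: "real \<Rightarrow> 'a measure" +
  fixes X M V :: "real \<Rightarrow> 'a \<Rightarrow> 'h::{real_inner, complete_space}"
    and \<tau> :: "nat \<Rightarrow> 'a \<Rightarrow> real"
  assumes M_adapted: "adapted P T F M" and V_adapted: "adapted P T F V"
    and V_bounded_variation: "AE \<omega> in P. bounded_variation_path T (\<lambda>t. V t \<omega>)"
    and X_eq: "\<And>t \<omega>. \<lbrakk>t \<in> {0..T}; \<omega> \<in> space P\<rbrakk> \<Longrightarrow> X t \<omega> = M t \<omega> + V t \<omega>"
    and \<tau>_stopping: "\<And>k. stopping_time (extend T F) (\<tau> k)"
    and \<tau>_range: "\<And>k \<omega>. \<omega> \<in> space P \<Longrightarrow> \<tau> k \<omega> \<in> {0..T}"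
    and \<tau>_localizes: "AE \<omega> in P. incseq (\<lambda>k. \<tau> k \<omega>) \<and> (\<exists>k. \<tau> k \<omega> = T)"
    and stopped_martingale: "\<And>k. is_martingale P T F (\<lambda>t \<omega>. M (min t (\<tau> k \<omega>)) \<omega> - M 0 \<omega>)"
    and X_continuous: "continuous_process P T X"
begin

sublocale whole: augmented_subalgebra P P
  by (rule augmented_subalgebra_self) (rule complete_measure_axioms)

definition mesh :: "nat \<Rightarrow> real" where
  "mesh m = T / 2 ^ m"

definition grid :: "nat \<Rightarrow> nat \<Rightarrow> real" where
  "grid m i = clip T (real i * mesh m)"

lemma mesh_pos: "0 < mesh m"
  using T_pos by (simp add: mesh_def)

lemma mesh_tendsto: "mesh \<longlonglongrightarrow> 0"
proof -
  have "(\<lambda>m. T * (1/2)^m) \<longlonglongrightarrow> T * 0"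
    by (intro tendsto_intros LIMSEQ_realpow_zero) auto
  then show ?thesis by (simp add: mesh_def[abs_def] power_divide)
qed

lemma grid_mem: "grid m i \<in> {0..T}"
  unfolding grid_def using T_pos by (rule clip_mem)

lemma grid_0: "grid m 0 = 0"
  using T_pos by (simp add: grid_def clip_def)

lemma grid_end: "grid m (2 ^ m) = T"
  using T_pos by (simp add: grid_def clip_def mesh_def)

lemma grid_mono: "i \<le> j \<Longrightarrow> grid m i \<le> grid m j"
  unfolding grid_def using mesh_pos[of m] by (intro clip_mono mult_right_mono) auto

lemma grid_dist: "i \<le> j \<Longrightarrow> \<bar>grid m j - grid m i\<bar> \<le> real (j - i) * mesh m"
  using mult_right_mono[of "real i" "real j" "mesh m"] mesh_pos[of m]
    clip_nonexpansive[of T "real j * mesh m" "real i * mesh m"]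
  by (simp add: grid_def of_nat_diff left_diff_distrib)

lemma F_subalgebra: "t \<in> {0..T} \<Longrightarrow> augmented_subalgebra P (F t)"
proof -
  assume t: "t \<in> {0..T}"
  have "sets (F 0) \<subseteq> sets (F t)"
    using sets_F_mono[of 0 t] t by (simp add: extend_def clip_idem)
  then show ?thesis
    using subalg[OF t] null_sets_F0 by unfold_locales auto
qed

lemma F_mono: "\<lbrakk>s \<in> {0..T}; t \<in> {0..T}; s \<le> t\<rbrakk> \<Longrightarrow> sets (F s) \<subseteq> sets (F t)"
  using sets_F_mono[of s t] by (simp add: extend_def clip_idem)

lemma F_later:
  assumes "s \<in> {0..T}" "t \<in> {0..T}" "s \<le> t" and "strongly_measurable P (F s) f"
  shows "strongly_measurable P (F t) f"
  using augmented_subalgebra.strongly_measurable_enlarge[OF F_subalgebra[OF assms(1)] assms(4) F_mono[OF assms(1-3)]]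
    augmented_subalgebra.space_eq[OF F_subalgebra[OF assms(2)]] by blast

lemma F_to_P: "\<lbrakk>t \<in> {0..T}; strongly_measurable P (F t) f\<rbrakk> \<Longrightarrow> strongly_measurable P P f"
  using augmented_subalgebra.strongly_measurable_enlarge[OF F_subalgebra, of t f P]
    augmented_subalgebra.sets_subset[OF F_subalgebra, of t] by blast

lemma X_adapted:
  assumes t: "t \<in> {0..T}"
  shows "strongly_measurable P (F t) (X t)"
proof -
  have "strongly_measurable P (F t) (\<lambda>\<omega>. M t \<omega> + V t \<omega>)"
    using t M_adapted V_adapted
    by (intro augmented_subalgebra.strongly_measurable_add[OF F_subalgebra]) (auto simp: adapted_def)
  then obtain s where s: "\<And>i. simple_function (F t) (s i)"
    "AE \<omega> in P. (\<lambda>i::nat. s i \<omega>) \<longlonglongrightarrow> M t \<omega> + V t \<omega>"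
    by (auto simp: strongly_measurable_def)
  have "AE \<omega> in P. (\<lambda>i. s i \<omega>) \<longlonglongrightarrow> X t \<omega>"
    using s(2) AE_space by eventually_elim (simp add: X_eq[OF t])
  then show ?thesis unfolding strongly_measurable_def using s(1) by blast
qed

lemma norm_diff_measurable:
  "(\<lambda>\<omega>. norm (X (grid m i) \<omega> - X (grid m j) \<omega>)) \<in> borel_measurable P"
  "(\<lambda>\<omega>. norm (V (grid m i) \<omega> - V (grid m j) \<omega>)) \<in> borel_measurable P"
proof -
  have "strongly_measurable P (F (grid m i)) (V (grid m i))" for i
    using V_adapted grid_mem by (simp add: adapted_def)
  from whole.strongly_measurable_diff[OF F_to_P[OF grid_mem this] F_to_P[OF grid_mem this]]
  show "(\<lambda>\<omega>. norm (V (grid m i) \<omega> - V (grid m j) \<omega>)) \<in> borel_measurable P"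
    by (rule whole.borel_measurable_norm_strong)
  from whole.strongly_measurable_diff[OF F_to_P[OF grid_mem X_adapted[OF grid_mem]] F_to_P[OF grid_mem X_adapted[OF grid_mem]]]
  show "(\<lambda>\<omega>. norm (X (grid m i) \<omega> - X (grid m j) \<omega>)) \<in> borel_measurable P"
    by (rule whole.borel_measurable_norm_strong)
qed

text \<open>
  The martingale on the grid is the one from the localisation. So the remainder \<open>y - \<mu>\<close> equals \<open>V - V\<^sub>0\<close> on the event
  \<open>\<tau>\<^sub>k = T\<close> only, but it is adapted everywhere.
\<close>

lemma grid_decomposition:
  assumes "0 \<le> n" "0 \<le> c"
  shows "grid_decomposition P (\<lambda>i. F (grid m i)) (\<lambda>i \<omega>. X (grid m i) \<omega> - X 0 \<omega>)
    (\<lambda>i \<omega>. M (min (grid m i) (\<tau> k \<omega>)) \<omega> - M 0 \<omega>) n c"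
proof unfold_locales
  fix i
  note sub = F_subalgebra[OF grid_mem, of m i]
  show "subalgebra P (F (grid m i))" using sub by (simp add: augmented_subalgebra_def augmented_subalgebra_axioms_def)
  show "null_sets P \<subseteq> sets (F (grid m i))" using sub by (simp add: augmented_subalgebra_def augmented_subalgebra_axioms_def)
  show "strongly_measurable P (F (grid m i)) (\<lambda>\<omega>. X (grid m i) \<omega> - X 0 \<omega>)"
    using T_pos grid_mem[of m i]
    by (intro augmented_subalgebra.strongly_measurable_diff[OF sub] X_adapted F_later[OF _ grid_mem _ X_adapted]) auto
next
  fix i j :: nat assume "i \<le> j"
  then show "sets (F (grid m i)) \<subseteq> sets (F (grid m j))" by (intro F_mono grid_mem grid_mono)
  show "is_cond_exp P (F (grid m i)) (\<lambda>\<omega>. M (min (grid m j) (\<tau> k \<omega>)) \<omega> - M 0 \<omega>)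
      (\<lambda>\<omega>. M (min (grid m i) (\<tau> k \<omega>)) \<omega> - M 0 \<omega>)"
    using stopped_martingale[of k] grid_mono[OF \<open>i \<le> j\<close>, of m] grid_mem[of m i] grid_mem[of m j]
    unfolding is_martingale_def by auto
next
  fix \<omega> assume "\<omega> \<in> space P"
  then show "M (min (grid m 0) (\<tau> k \<omega>)) \<omega> - M 0 \<omega> = 0"
    using \<tau>_range[of \<omega> k] by (simp add: grid_0)
qed (use assms in \<open>auto simp: grid_0\<close>)

lemma localizing_event:
  assumes "0 < \<eta>"
  obtains k A where "A \<in> events" "prob (space P - A) \<le> \<eta>" "\<And>\<omega>. \<omega> \<in> A \<Longrightarrow> \<tau> k \<omega> = T"
proof -
  define A where "A k = {\<omega>\<in>space P. \<tau> k \<omega> = T}" for k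
  have [measurable]: "\<tau> k \<in> borel_measurable P" for k
  proof (rule measurable_stopping_time[OF \<tau>_stopping])
    fix t
    note sub = F_subalgebra[OF clip_mem[OF T_pos], of t]
    show "sets (extend T F t) \<subseteq> sets P" "space (extend T F t) = space P"
      unfolding extend_def using augmented_subalgebra.sets_subset[OF sub] augmented_subalgebra.space_eq[OF sub] by auto
  qed
  have A: "A k \<in> events" for k unfolding A_def by measurable
  have "AE \<omega> in P. eventually (\<lambda>k. \<omega> \<in> A k) sequentially"
    using \<tau>_localizes AE_space
  proof eventually_elim
    case (elim \<omega>)
    then obtain k where k: "\<tau> k \<omega> = T" by auto
    have "\<omega> \<in> A j" if "k \<le> j" for j
      using elim incseqD[of "\<lambda>k. \<tau> k \<omega>" k j] k that \<tau>_range[of \<omega> j] by (auto simp: A_def)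
    then show ?case by (auto simp: eventually_sequentially)
  qed
  from exhausting_events[OF A this assms] obtain k where "prob (space P - A k) \<le> \<eta>" .
  then show thesis using A by (intro that[of "A k" k]) (auto simp: A_def)
qed

text \<open>
  The variation along all dyadic grids involves countably many random variables, in contrast to
  the variation over all partitions. Hence the event below is measurable.
\<close>

lemma variation_event:
  assumes "0 < \<eta>"
  obtains n A where "A \<in> events" "prob (space P - A) \<le> \<eta>" "0 \<le> n"
    "\<And>\<omega> m. \<omega> \<in> A \<Longrightarrow> (\<Sum>i<2^m. norm (V (grid m (Suc i)) \<omega> - V (grid m i) \<omega>)) \<le> n"
proof -
  define A where "A k = {\<omega>\<in>space P. \<forall>m. (\<Sum>i<2^m. norm (V (grid m (Suc i)) \<omega> - V (grid m i) \<omega>)) \<le> real k}" for k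
  note [measurable] = norm_diff_measurable
  have A: "A k \<in> events" for k unfolding A_def by measurable
  have "AE \<omega> in P. eventually (\<lambda>k. \<omega> \<in> A k) sequentially"
    using V_bounded_variation AE_space
  proof eventually_elim
    case (elim \<omega>)
    then obtain C where C: "\<And>(p :: nat \<Rightarrow> real) n. mono p \<Longrightarrow> range p \<subseteq> {0..T} \<Longrightarrow>
        (\<Sum>i<n. norm (V (p (Suc i)) \<omega> - V (p i) \<omega>)) \<le> C"
      unfolding bounded_variation_path_def by blast
    have "(\<Sum>i<2^m. norm (V (grid m (Suc i)) \<omega> - V (grid m i) \<omega>)) \<le> C" for m
      using grid_mem by (intro C) (auto simp: mono_def grid_mono)
    then have "\<omega> \<in> A k" if "C \<le> real k" for k
      unfolding A_def using elim(2) by (auto intro: order_trans[OF _ that])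
    moreover have "eventually (\<lambda>k. C \<le> real k) sequentially"
      by (rule eventually_mono[OF eventually_ge_at_top[of "nat \<lceil>C\<rceil>"]]) linarith
    ultimately show ?case by (auto elim: eventually_mono)
  qed
  from exhausting_events[OF A this assms] obtain k where "prob (space P - A k) \<le> \<eta>" .
  then show thesis using A by (intro that[of "A k" "real k"]) (auto simp: A_def)
qed

lemma path_bounded:
  assumes "continuous_on {0..T} (\<lambda>t. X t \<omega>)"
  obtains C where "\<And>t. t \<in> {0..T} \<Longrightarrow> norm (X t \<omega>) \<le> C"
proof -
  have "compact ((\<lambda>t. X t \<omega>) ` {0..T})" using assms by (rule compact_continuous_image) simp
  then have "bounded ((\<lambda>t. X t \<omega>) ` {0..T})" by (rule compact_imp_bounded)
  then obtain C where "\<forall>x\<in>(\<lambda>t. X t \<omega>) ` {0..T}. norm x \<le> C" unfolding bounded_iff ..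
  then show thesis by (intro that[of C]) auto
qed

lemma bounded_event:
  assumes "0 < \<eta>"
  obtains c A where "A \<in> events" "prob (space P - A) \<le> \<eta>" "0 \<le> c"
    "\<And>\<omega> m i. \<omega> \<in> A \<Longrightarrow> norm (X (grid m i) \<omega> - X 0 \<omega>) \<le> c"
proof -
  define A where "A k = {\<omega>\<in>space P. \<forall>m i. norm (X (grid m i) \<omega> - X (grid m 0) \<omega>) \<le> real k}" for k
  note [measurable] = norm_diff_measurable
  have A: "A k \<in> events" for k unfolding A_def by measurable
  have "AE \<omega> in P. eventually (\<lambda>k. \<omega> \<in> A k) sequentially"
    using X_continuous[unfolded continuous_process_def] AE_space
  proof eventually_elim
    case (elim \<omega>)
    then obtain C where C: "\<And>t. t \<in> {0..T} \<Longrightarrow> norm (X t \<omega>) \<le> C"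
      using path_bounded[OF elim(1)] by blast
    have "norm (X (grid m i) \<omega> - X (grid m 0) \<omega>) \<le> 2 * C" for m i
      using norm_triangle_ineq4[of "X (grid m i) \<omega>" "X (grid m 0) \<omega>"] C[OF grid_mem, of m i] C[OF grid_mem, of m 0] by simp
    then have "\<omega> \<in> A k" if "2 * C \<le> real k" for k
      unfolding A_def using elim(2) by (auto intro: order_trans[OF _ that])
    moreover have "eventually (\<lambda>k. 2 * C \<le> real k) sequentially"
      by (rule eventually_mono[OF eventually_ge_at_top[of "nat \<lceil>2 * C\<rceil>"]]) linarith
    ultimately show ?case by (auto elim: eventually_mono)
  qed
  from exhausting_events[OF A this assms] obtain k where "prob (space P - A k) \<le> \<eta>" .
  then show thesis using A by (intro that[of "A k" "real k"]) (auto simp: A_def grid_0)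
qed

lemma oscillation_event:
  assumes "0 < \<eta>" "0 < \<delta>"
  obtains e A where "A \<in> events" "prob (space P - A) \<le> \<eta>" "0 < e"
    "\<And>\<omega> m i j. \<lbrakk>\<omega> \<in> A; \<bar>grid m i - grid m j\<bar> \<le> e\<rbrakk> \<Longrightarrow> norm (X (grid m i) \<omega> - X (grid m j) \<omega>) \<le> \<delta>"
proof -
  define A where "A k = {\<omega>\<in>space P. \<forall>m i j. \<bar>grid m i - grid m j\<bar> \<le> 1 / real (Suc k) \<longrightarrow>
      norm (X (grid m i) \<omega> - X (grid m j) \<omega>) \<le> \<delta>}" for k
  note [measurable] = norm_diff_measurable
  have A: "A k \<in> events" for k unfolding A_def by measurable
  have "AE \<omega> in P. eventually (\<lambda>k. \<omega> \<in> A k) sequentially"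
    using X_continuous[unfolded continuous_process_def] AE_space
  proof eventually_elim
    case (elim \<omega>)
    have "uniformly_continuous_on {0..T} (\<lambda>t. X t \<omega>)"
      using elim(1) by (rule compact_uniformly_continuous) simp
    then obtain r where r: "0 < r"
      "\<And>s t. \<lbrakk>s \<in> {0..T}; t \<in> {0..T}; dist t s < r\<rbrakk> \<Longrightarrow> dist (X t \<omega>) (X s \<omega>) < \<delta>"
      unfolding uniformly_continuous_on_def using \<open>0 < \<delta>\<close> by metis
    have "eventually (\<lambda>k. 1 / real (Suc k) < r) sequentially"
      using r(1) by (intro order_tendstoD(2)[OF LIMSEQ_Suc[OF lim_1_over_n]]) auto
    then show ?case
    proof eventually_elim
      case (elim k)
      show ?case unfolding A_def
      proof (intro CollectI conjI allI impI)
        fix m i j assume "\<bar>grid m i - grid m j\<bar> \<le> 1 / real (Suc k)"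
        then have "dist (grid m i) (grid m j) < r" using elim by (simp add: dist_real_def)
        from r(2)[OF grid_mem grid_mem this]
        show "norm (X (grid m i) \<omega> - X (grid m j) \<omega>) \<le> \<delta>" by (simp add: dist_norm)
      qed (rule \<open>\<omega> \<in> space P\<close>)
    qed
  qed
  from exhausting_events[OF A this assms(1)] obtain k where "prob (space P - A k) \<le> \<eta>" .
  then show thesis using A by (intro that[of "A k" "1 / real (Suc k)"]) (auto simp: A_def)
qed

definition lag :: "real \<Rightarrow> nat \<Rightarrow> nat" where
  "lag \<epsilon> m = nat \<lfloor>\<epsilon> / mesh m\<rfloor>"

definition discrete_approx :: "real \<Rightarrow> nat \<Rightarrow> nat \<Rightarrow> 'a \<Rightarrow> real" where
  "discrete_approx \<epsilon> m N \<omega> =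
    (\<Sum>i<N. (norm (X (grid m (i + lag \<epsilon> m)) \<omega> - X (grid m i) \<omega>))\<^sup>2) / real (lag \<epsilon> m)"

definition dyadic_qv :: "nat \<Rightarrow> nat \<Rightarrow> 'a \<Rightarrow> real" where
  "dyadic_qv m N \<omega> = (\<Sum>i<N. (norm (X (grid m (Suc i)) \<omega> - X (grid m i) \<omega>))\<^sup>2)"

lemma lag_le: "0 < \<epsilon> \<Longrightarrow> real (lag \<epsilon> m) * mesh m \<le> \<epsilon>"
proof -
  assume "0 < \<epsilon>"
  then have "real (lag \<epsilon> m) \<le> \<epsilon> / mesh m" unfolding lag_def using mesh_pos[of m] by simp
  then show ?thesis using mesh_pos[of m] by (simp add: pos_le_divide_eq)
qed

lemma lag_pos: "mesh m \<le> \<epsilon> \<Longrightarrow> 0 < lag \<epsilon> m"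
  unfolding lag_def using mesh_pos[of m] by (simp add: field_simps)

text \<open>
  The order of choice matters: the localisation and the levels \<open>n\<close> and \<open>c\<close> fix the constants of the maximal
  inequality, which are the same for all grids because every grid ends at \<open>T\<close>. Only then the oscillation
  \<open>\<delta>\<close> is chosen, and last the range of the time shifts \<open>\<epsilon>\<close>.
\<close>

lemma discrete_approx_near_dyadic_qv:
  assumes \<eta>: "0 < \<eta>"
  obtains e A where "0 < e" "A \<in> events" "prob (space P - A) \<le> \<eta>"
    "\<And>\<epsilon> m. \<lbrakk>0 < \<epsilon>; \<epsilon> < e; mesh m \<le> \<epsilon>\<rbrakk> \<Longrightarrow> \<exists>B\<in>events. prob B \<le> \<eta> \<and>
      (\<forall>\<omega>\<in>A - B. \<forall>N\<le>2^m. \<bar>discrete_approx \<epsilon> m N \<omega> - dyadic_qv m N \<omega>\<bar> \<le> \<eta>)"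
proof -
  have \<eta>4: "0 < \<eta> / 4" using \<eta> by simp
  obtain k A1 where A1: "A1 \<in> events" "prob (space P - A1) \<le> \<eta> / 4" "\<And>\<omega>. \<omega> \<in> A1 \<Longrightarrow> \<tau> k \<omega> = T"
    by (rule localizing_event[OF \<eta>4]) (rule that)
  obtain n A2 where A2: "A2 \<in> events" "prob (space P - A2) \<le> \<eta> / 4" "0 \<le> n"
    "\<And>\<omega> m. \<omega> \<in> A2 \<Longrightarrow> (\<Sum>i<2^m. norm (V (grid m (Suc i)) \<omega> - V (grid m i) \<omega>)) \<le> n"
    by (rule variation_event[OF \<eta>4]) (rule that)
  obtain c A3 where A3: "A3 \<in> events" "prob (space P - A3) \<le> \<eta> / 4" "0 \<le> c"
    "\<And>\<omega> m i. \<omega> \<in> A3 \<Longrightarrow> norm (X (grid m i) \<omega> - X 0 \<omega>) \<le> c"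
    by (rule bounded_event[OF \<eta>4]) (rule that)
  define K where "K = c + 2 * n + (\<integral>\<omega>. norm (M (min T (\<tau> k \<omega>)) \<omega> - M 0 \<omega>) \<partial>P)"
  define C where "C = c\<^sup>2 + 2 * c * K"
  define l where "l = \<eta> / 4"
  have l: "0 < l" using \<eta> by (simp add: l_def)
  have "((\<lambda>\<delta>. (\<delta>\<^sup>2 * C + 2 * l * \<delta> * K) / l\<^sup>2) \<longlongrightarrow> (0\<^sup>2 * C + 2 * l * 0 * K) / l\<^sup>2) (at_right 0)"
    using l by (intro tendsto_intros) auto
  then have ev1: "eventually (\<lambda>\<delta>. (\<delta>\<^sup>2 * C + 2 * l * \<delta> * K) / l\<^sup>2 < \<eta>) (at_right 0)"
    using \<eta> by (intro order_tendstoD) auto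
  have "((\<lambda>\<delta>. 2 * \<delta>\<^sup>2) \<longlongrightarrow> 2 * 0\<^sup>2) (at_right (0::real))" by (intro tendsto_intros)
  then have ev2: "eventually (\<lambda>\<delta>::real. 2 * \<delta>\<^sup>2 < \<eta> / 2) (at_right 0)"
    using \<eta> by (intro order_tendstoD) auto
  have "eventually (\<lambda>\<delta>::real. 0 < \<delta> \<and> (\<delta>\<^sup>2 * C + 2 * l * \<delta> * K) / l\<^sup>2 < \<eta> \<and> 2 * \<delta>\<^sup>2 < \<eta> / 2) (at_right 0)"
    using ev1 ev2 eventually_at_right_less[of "0::real"] by eventually_elim auto
  then obtain \<delta> :: real where \<delta>: "0 < \<delta>" "(\<delta>\<^sup>2 * C + 2 * l * \<delta> * K) / l\<^sup>2 < \<eta>" "2 * \<delta>\<^sup>2 < \<eta> / 2"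
    by (metis (no_types, lifting) eventually_happens trivial_limit_at_right_real)
  obtain e A4 where A4: "A4 \<in> events" "prob (space P - A4) \<le> \<eta> / 4" "0 < e"
    "\<And>\<omega> m i j. \<lbrakk>\<omega> \<in> A4; \<bar>grid m i - grid m j\<bar> \<le> e\<rbrakk> \<Longrightarrow> norm (X (grid m i) \<omega> - X (grid m j) \<omega>) \<le> \<delta>"
    by (rule oscillation_event[OF \<eta>4 \<delta>(1)]) (rule that)
  define A where "A = A1 \<inter> A2 \<inter> A3 \<inter> A4"
  show thesis
  proof (rule that[of e A])
    show "0 < e" by fact
    show "A \<in> events" unfolding A_def using A1 A2 A3 A4 by auto
    have "space P - A = (space P - A1) \<union> (space P - A2) \<union> (space P - A3) \<union> (space P - A4)"
      by (auto simp: A_def)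
    also have "prob \<dots> \<le> prob ((space P - A1) \<union> (space P - A2) \<union> (space P - A3)) + prob (space P - A4)"
      using A1 A2 A3 A4 by (intro measure_Un_le) auto
    also have "prob ((space P - A1) \<union> (space P - A2) \<union> (space P - A3)) \<le>
        prob ((space P - A1) \<union> (space P - A2)) + prob (space P - A3)"
      using A1 A2 A3 by (intro measure_Un_le) auto
    also have "prob ((space P - A1) \<union> (space P - A2)) \<le> prob (space P - A1) + prob (space P - A2)"
      using A1 A2 by (intro measure_Un_le) auto
    finally show "prob (space P - A) \<le> \<eta>" using A1(2) A2(2) A3(2) A4(2) by simp
  next
    fix \<epsilon> m assume \<epsilon>: "0 < \<epsilon>" "\<epsilon> < e" "mesh m \<le> \<epsilon>"
    define q where "q = lag \<epsilon> m"
    have q: "0 < q" "real q * mesh m \<le> \<epsilon>" unfolding q_def using \<epsilon> by (auto intro: lag_pos lag_le)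
    interpret D: grid_decomposition P "\<lambda>i. F (grid m i)" "\<lambda>i \<omega>. X (grid m i) \<omega> - X 0 \<omega>"
      "\<lambda>i \<omega>. M (min (grid m i) (\<tau> k \<omega>)) \<omega> - M 0 \<omega>" n c
      using A2(3) A3(3) by (rule grid_decomposition)
    define H where "H i \<omega> = (1 / real q) *\<^sub>R (\<Sum>j<q. X (grid m i) \<omega> - X (grid m (i - j)) \<omega>)" for i \<omega>
    have H: "strongly_measurable P (F (grid m i)) (H i)" for i
      unfolding H_def
      by (intro D.sub.strongly_measurable_scaleR D.sub.strongly_measurable_sum D.sub.strongly_measurable_diff
          X_adapted grid_mem F_later[OF grid_mem grid_mem grid_mono X_adapted[OF grid_mem]]) auto
    have K: "D.quasimartingale_const (2^m) = K" and C: "D.square_const (2^m) = C"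
      by (simp_all add: D.quasimartingale_const_def K_def D.square_const_def C_def grid_end)
    obtain B where B: "B \<in> events" "prob B \<le> (\<delta>\<^sup>2 * C + 2 * l * \<delta> * K) / l\<^sup>2"
      "\<forall>\<omega>\<in>D.controlled (2^m) - B. (\<forall>i<2^m. norm (H i \<omega>) \<le> \<delta>) \<longrightarrow> (\<forall>k\<le>2^m.
        \<bar>\<Sum>i<k. H i \<omega> \<bullet> ((X (grid m (Suc i)) \<omega> - X 0 \<omega>) - (X (grid m i) \<omega> - X 0 \<omega>))\<bar> \<le> l)"
      by (rule D.maximal_inequality[OF H less_imp_le[OF \<delta>(1)] l, of "2^m", unfolded K C]) (rule that)
    show "\<exists>B\<in>events. prob B \<le> \<eta> \<and>
      (\<forall>\<omega>\<in>A - B. \<forall>N\<le>2^m. \<bar>discrete_approx \<epsilon> m N \<omega> - dyadic_qv m N \<omega>\<bar> \<le> \<eta>)"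
    proof (intro bexI[of _ B] conjI ballI allI impI)
      show "prob B \<le> \<eta>" using B(2) \<delta>(2) by simp
      fix \<omega> N assume \<omega>: "\<omega> \<in> A - B" and N: "N \<le> (2::nat)^m"
      have in_space: "\<omega> \<in> space P" using \<omega> A1(1) sets.sets_into_space by (auto simp: A_def)
      have "D.remainder i \<omega> = V (grid m i) \<omega> - V 0 \<omega>" for i
      proof -
        have "min (grid m i) (\<tau> k \<omega>) = grid m i" using A1(3)[of \<omega>] \<omega> grid_mem[of m i] by (auto simp: A_def)
        then show ?thesis
          unfolding D.remainder_def using X_eq[OF grid_mem in_space, of m i] X_eq[of 0 \<omega>] T_pos in_space by simp
      qed
      then have "\<omega> \<in> D.controlled (2^m)"
        unfolding D.controlled_def using in_space A2(4)[of \<omega> m] A3(4)[of \<omega> m] \<omega> by (auto simp: A_def)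
      then have R: "\<omega> \<in> D.controlled (2^m) - B" using \<omega> by simp
      have osc: "norm (X (grid m b) \<omega> - X (grid m a) \<omega>) \<le> \<delta>" if "a \<le> b" "b \<le> a + q" for a b
      proof (rule A4(4))
        have "\<bar>grid m b - grid m a\<bar> \<le> real (b - a) * mesh m" by (rule grid_dist[OF that(1)])
        also have "\<dots> \<le> real q * mesh m" using that mesh_pos[of m] by (intro mult_right_mono) auto
        finally show "\<bar>grid m b - grid m a\<bar> \<le> e" using q \<epsilon> by simp
      qed (use \<omega> in \<open>simp add: A_def\<close>)
      note near = averaged_squares_near_quadratic_variation[where x="\<lambda>i. X (grid m i) \<omega>" and \<delta>=\<delta>, OF q(1) osc]
      have "norm (H i \<omega>) \<le> \<delta>" for i unfolding H_def by (rule near(1))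
      then have "\<bar>\<Sum>i<N. H i \<omega> \<bullet> (X (grid m (Suc i)) \<omega> - X (grid m i) \<omega>)\<bar> \<le> l"
        using B(3)[rule_format, OF R _ N] by simp
      moreover have "\<bar>discrete_approx \<epsilon> m N \<omega> - dyadic_qv m N \<omega>\<bar>
          \<le> 2 * \<delta>\<^sup>2 + 2 * \<bar>\<Sum>i<N. H i \<omega> \<bullet> (X (grid m (Suc i)) \<omega> - X (grid m i) \<omega>)\<bar>"
        unfolding discrete_approx_def dyadic_qv_def H_def q_def[symmetric] by (rule near(2))
      ultimately show "\<bar>discrete_approx \<epsilon> m N \<omega> - dyadic_qv m N \<omega>\<bar> \<le> \<eta>"
        using \<delta>(3) by (simp add: l_def)
    qed (rule B(1))
  qed
qed

lemma extended_path:
  assumes "continuous_on {0..T} (\<lambda>t. X t \<omega>)"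
  shows "continuous_on UNIV (\<lambda>s. extend T X s \<omega>)"
  unfolding extend_def
  by (rule continuous_on_compose2[OF assms continuous_on_clip]) (use clip_mem[OF T_pos] in auto)

lemma discrete_approx_tendsto:
  assumes cont: "continuous_on {0..T} (\<lambda>t. X t \<omega>)" and \<epsilon>: "0 < \<epsilon>" and t: "t \<in> {0..T}"
  shows "(\<lambda>m. discrete_approx \<epsilon> m (nat \<lfloor>t / mesh m\<rfloor>) \<omega>) \<longlonglongrightarrow> qv_approx T X \<epsilon> t \<omega>"
proof -
  obtain C where C: "\<And>t. t \<in> {0..T} \<Longrightarrow> norm (X t \<omega>) \<le> C" by (rule path_bounded[OF cont]) (rule that)
  have bdd: "norm (extend T X s \<omega>) \<le> C" for s
    unfolding extend_def by (rule C[OF clip_mem[OF T_pos]])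
  have "0 \<le> t" using t by simp
  from riemann_sum_averaged_squares[OF extended_path[OF cont] bdd mesh_pos mesh_tendsto \<epsilon> this]
  show ?thesis
    unfolding discrete_approx_def qv_approx_def lag_def grid_def extend_def .
qed

lemma discrete_approx_measurable: "discrete_approx \<epsilon> m N \<in> borel_measurable P"
proof -
  note [measurable] = norm_diff_measurable(1)
  show ?thesis unfolding discrete_approx_def[abs_def] by measurable
qed

lemma qv_approx_measurable:
  assumes "0 < \<epsilon>" "t \<in> {0..T}"
  shows "qv_approx T X \<epsilon> t \<in> borel_measurable P"
proof (rule whole.borel_measurable_AE_limit[OF discrete_approx_measurable])
  show "AE \<omega> in P. (\<lambda>m. discrete_approx \<epsilon> m (nat \<lfloor>t / mesh m\<rfloor>) \<omega>) \<longlonglongrightarrow> qv_approx T X \<epsilon> t \<omega>"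
    using X_continuous[unfolded continuous_process_def]
    by eventually_elim (rule discrete_approx_tendsto[OF _ assms])
qed

lemma qv_approx_continuous:
  assumes cont: "continuous_on {0..T} (\<lambda>t. X t \<omega>)"
  shows "continuous_on {0..T} (\<lambda>t. qv_approx T X \<epsilon> t \<omega>)"
proof -
  define g where "g s = (norm (extend T X (s + \<epsilon>) \<omega> - extend T X s \<omega>))\<^sup>2 / \<epsilon>" for s
  have g: "continuous_on S g" for S
    unfolding g_def
    by (cases "\<epsilon> = 0") (auto intro!: continuous_intros continuous_on_compose2[OF extended_path[OF cont]]
      continuous_on_subset[OF extended_path[OF cont]])
  have "qv_approx T X \<epsilon> t \<omega> = integral {0..t} g" for t
    unfolding qv_approx_def g_def[symmetric]
    by (rule set_borel_integral_eq_integral(2)) (rule borel_integrable_atLeastAtMost'[OF g])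
  then show ?thesis
    using indefinite_integral_continuous_1[OF integrable_continuous_interval[OF g], of 0 T] by simp
qed

text \<open>
  For given shifts \<open>\<epsilon>\<close> and \<open>\<epsilon>'\<close>, the comparison with the dyadic sums holds on every sufficiently fine grid outside
  of an event \<open>D\<^sub>m\<close> that depends on the grid. Outside of their limes inferior, the estimate holds for
  infinitely many grids, and so for the limits of the Riemann sums at every time \<open>t\<close> simultaneously.
\<close>

lemma qv_approx_Cauchy:
  assumes \<eta>: "0 < \<eta>"
  shows "\<exists>\<epsilon>\<^sub>0>0. \<forall>\<epsilon>\<in>{0<..<\<epsilon>\<^sub>0}. \<forall>\<epsilon>'\<in>{0<..<\<epsilon>\<^sub>0}. \<exists>B\<in>events. prob B \<le> \<eta> \<and>
      (\<forall>\<omega>\<in>space P - B. \<forall>t\<in>{0..T}. \<bar>qv_approx T X \<epsilon> t \<omega> - qv_approx T X \<epsilon>' t \<omega>\<bar> \<le> \<eta>)"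
proof -
  define r where "r = \<eta> / 3"
  have r: "0 < r" using \<eta> by (simp add: r_def)
  obtain e A where e: "0 < e" and A: "A \<in> events" "prob (space P - A) \<le> r"
    and near: "\<And>\<epsilon> m. \<lbrakk>0 < \<epsilon>; \<epsilon> < e; mesh m \<le> \<epsilon>\<rbrakk> \<Longrightarrow> \<exists>B\<in>events. prob B \<le> r \<and>
      (\<forall>\<omega>\<in>A - B. \<forall>N\<le>2^m. \<bar>discrete_approx \<epsilon> m N \<omega> - dyadic_qv m N \<omega>\<bar> \<le> r)"
    using discrete_approx_near_dyadic_qv[OF r] by metis
  obtain Z where Z: "Z \<in> null_sets P" "{\<omega>\<in>space P. \<not> continuous_on {0..T} (\<lambda>t. X t \<omega>)} \<subseteq> Z"
    using X_continuous by (auto simp: continuous_process_def eventually_ae_filter)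
  show ?thesis
  proof (intro exI[of _ e] conjI ballI)
    fix \<epsilon> \<epsilon>' assume \<epsilon>: "\<epsilon> \<in> {0<..<e}" and \<epsilon>': "\<epsilon>' \<in> {0<..<e}"
    have "eventually (\<lambda>m. mesh m < min \<epsilon> \<epsilon>') sequentially"
      using \<epsilon> \<epsilon>' by (intro order_tendstoD(2)[OF mesh_tendsto]) auto
    then obtain m0 where "\<forall>m\<ge>m0. mesh m < min \<epsilon> \<epsilon>'"
      unfolding eventually_sequentially by blast
    then have m0: "mesh m \<le> \<epsilon> \<and> mesh m \<le> \<epsilon>'" if "m0 \<le> m" for m
      using that by (auto simp: less_imp_le)
    have "\<exists>D. D \<in> events \<and> prob D \<le> 2 * r \<and>
        (m0 \<le> m \<longrightarrow> (\<forall>\<omega>\<in>A - D. \<forall>N\<le>2^m. \<bar>discrete_approx \<epsilon> m N \<omega> - discrete_approx \<epsilon>' m N \<omega>\<bar> \<le> 2 * r))" for m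
    proof (cases "m0 \<le> m")
      case True
      obtain B where B: "B \<in> events" "prob B \<le> r"
        "\<And>\<omega> N. \<lbrakk>\<omega> \<in> A - B; N \<le> 2^m\<rbrakk> \<Longrightarrow> \<bar>discrete_approx \<epsilon> m N \<omega> - dyadic_qv m N \<omega>\<bar> \<le> r"
        using near[of \<epsilon> m] \<epsilon> m0[OF True] by auto
      obtain B' where B': "B' \<in> events" "prob B' \<le> r"
        "\<And>\<omega> N. \<lbrakk>\<omega> \<in> A - B'; N \<le> 2^m\<rbrakk> \<Longrightarrow> \<bar>discrete_approx \<epsilon>' m N \<omega> - dyadic_qv m N \<omega>\<bar> \<le> r"
        using near[of \<epsilon>' m] \<epsilon>' m0[OF True] by auto
      have "\<bar>discrete_approx \<epsilon> m N \<omega> - discrete_approx \<epsilon>' m N \<omega>\<bar> \<le> 2 * r"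
        if "\<omega> \<in> A - (B \<union> B')" "N \<le> 2^m" for \<omega> N
        using B(3)[of \<omega> N] B'(3)[of \<omega> N] that by auto
      moreover have "prob (B \<union> B') \<le> 2 * r"
        using measure_Un_le[of B P B'] B B' by simp
      ultimately show ?thesis using B(1) B'(1) by (intro exI[of _ "B \<union> B'"]) auto
    qed (use r in \<open>auto intro!: exI[of _ "{}"]\<close>)
    then obtain D where D: "\<And>m. D m \<in> events" "\<And>m. prob (D m) \<le> 2 * r"
      "\<And>m \<omega> N. \<lbrakk>m0 \<le> m; \<omega> \<in> A - D m; N \<le> 2^m\<rbrakk> \<Longrightarrow>
        \<bar>discrete_approx \<epsilon> m N \<omega> - discrete_approx \<epsilon>' m N \<omega>\<bar> \<le> 2 * r"
      by metis
    define L where "L = (\<Union>k. \<Inter>m\<in>{k..}. D m)"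
    have L: "L \<in> events" "prob L \<le> 2 * r"
      unfolding L_def by (rule liminf_events_le[OF D(1,2)])+
    define B where "B = (space P - A) \<union> L \<union> Z"
    show "\<exists>B\<in>events. prob B \<le> \<eta> \<and>
      (\<forall>\<omega>\<in>space P - B. \<forall>t\<in>{0..T}. \<bar>qv_approx T X \<epsilon> t \<omega> - qv_approx T X \<epsilon>' t \<omega>\<bar> \<le> \<eta>)"
    proof (intro bexI[of _ B] conjI ballI)
      show "B \<in> events" unfolding B_def using A L Z by auto
      have "prob B \<le> prob ((space P - A) \<union> L) + prob Z"
        unfolding B_def using A L Z by (intro measure_Un_le) auto
      also have "prob Z = 0" using Z by (simp add: null_sets_def measure_def)
      also have "prob ((space P - A) \<union> L) \<le> prob (space P - A) + prob L"
        using A L by (intro measure_Un_le) auto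
      finally show "prob B \<le> \<eta>" using A(2) L(2) by (simp add: r_def)
    next
      fix \<omega> t assume \<omega>: "\<omega> \<in> space P - B" and t: "t \<in> {0..T}"
      have cont: "continuous_on {0..T} (\<lambda>t. X t \<omega>)" and \<omega>A: "\<omega> \<in> A" and \<omega>L: "\<omega> \<notin> L"
        using \<omega> Z(2) by (auto simp: B_def)
      let ?N = "\<lambda>m. nat \<lfloor>t / mesh m\<rfloor>"
      have N: "?N m \<le> 2^m" for m
      proof -
        have "t / mesh m \<le> T / mesh m" using t mesh_pos[of m] by (intro divide_right_mono) auto
        also have "T / mesh m = 2^m" using T_pos by (simp add: mesh_def)
        finally have "\<lfloor>t / mesh m\<rfloor> \<le> \<lfloor>2^m :: real\<rfloor>" by (rule floor_mono)
        also have "\<lfloor>2^m :: real\<rfloor> = int (2^m)" by simp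
        finally show ?thesis by (simp add: nat_le_iff)
      qed
      have lim: "(\<lambda>m. \<bar>discrete_approx \<epsilon> m (?N m) \<omega> - discrete_approx \<epsilon>' m (?N m) \<omega>\<bar>)
          \<longlonglongrightarrow> \<bar>qv_approx T X \<epsilon> t \<omega> - qv_approx T X \<epsilon>' t \<omega>\<bar>"
        using \<epsilon> \<epsilon>' t by (intro tendsto_intros discrete_approx_tendsto[OF cont]) auto
      have "\<bar>qv_approx T X \<epsilon> t \<omega> - qv_approx T X \<epsilon>' t \<omega>\<bar> \<le> 2 * r"
      proof (rule ccontr)
        assume "\<not> ?thesis"
        then have "eventually (\<lambda>m. 2 * r < \<bar>discrete_approx \<epsilon> m (?N m) \<omega> - discrete_approx \<epsilon>' m (?N m) \<omega>\<bar>) sequentially"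
          by (intro order_tendstoD(1)[OF lim]) simp
        then obtain m1 where m1: "\<And>m. m1 \<le> m \<Longrightarrow>
            2 * r < \<bar>discrete_approx \<epsilon> m (?N m) \<omega> - discrete_approx \<epsilon>' m (?N m) \<omega>\<bar>"
          unfolding eventually_sequentially by blast
        have "\<exists>m\<in>{max m0 m1..}. \<omega> \<notin> D m"
          using \<omega>L unfolding L_def by blast
        then obtain m where "max m0 m1 \<le> m" "\<omega> \<notin> D m" by auto
        then show False using m1[of m] D(3)[of m \<omega>, OF _ _ N] \<omega>A by fastforce
      qed
      then show "\<bar>qv_approx T X \<epsilon> t \<omega> - qv_approx T X \<epsilon>' t \<omega>\<bar> \<le> \<eta>" using r by (simp add: r_def)
    qed
  qed (rule e)
qed

lemma scalar_qv_exists: "admits_scalar_qv P T X"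
proof -
  have "AE \<omega> in P. \<forall>\<epsilon>>0. continuous_on {0..T} (\<lambda>t. qv_approx T X \<epsilon> t \<omega>)"
    using X_continuous[unfolded continuous_process_def]
    by eventually_elim (simp add: qv_approx_continuous)
  from ucp_Cauchy_imp_convergent[where Y="qv_approx T X", OF prob_space_axioms qv_approx_measurable this qv_approx_Cauchy]
  obtain Q where "\<forall>t\<in>{0..T}. Q t \<in> borel_measurable P"
    "continuous_process P T Q" "ucp_tendsto P T (qv_approx T X) Q (at_right 0)" .
  then show ?thesis unfolding admits_scalar_qv_def is_scalar_qv_def by blast
qed

end

theorem proposition1p8:
  fixes P :: "'a measure" and T :: real and F :: "real \<Rightarrow> 'a measure"
    and X :: "real \<Rightarrow> 'a \<Rightarrow> 'h::{real_inner, complete_space}"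
  assumes "usual_filtered_prob_space P T F"
    and "is_semimartingale P T F X"
    and "continuous_process P T X"
  shows "admits_scalar_qv P T X"
proof -
  obtain M V where M: "is_local_martingale P T F M" and V: "adapted P T F V"
      "AE \<omega> in P. bounded_variation_path T (\<lambda>t. V t \<omega>)"
    and X: "\<forall>t\<in>{0..T}. \<forall>\<omega>\<in>space P. X t \<omega> = M t \<omega> + V t \<omega>"
    using assms(2) by (auto simp: is_semimartingale_def)
  obtain \<tau> :: "nat \<Rightarrow> 'a \<Rightarrow> real" where \<tau>:
    "\<forall>n. stopping_time (extend T F) (\<tau> n) \<and> \<tau> n \<in> space P \<rightarrow> {0..T}"
    "AE \<omega> in P. incseq (\<lambda>n. \<tau> n \<omega>) \<and> (\<exists>n. \<tau> n \<omega> = T)"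
    "\<forall>n. is_martingale P T F (\<lambda>t \<omega>. M (min t (\<tau> n \<omega>)) \<omega> - M 0 \<omega>)"
    using M unfolding is_local_martingale_def by auto
  interpret usual_filtered_prob_space P T F by fact
  interpret semimartingale_decomposition P T F X M V \<tau>
    using M V X \<tau> assms(3) by unfold_locales (auto simp: is_local_martingale_def Pi_iff)
  show ?thesis by (rule scalar_qv_exists)
qed

end
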